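(* For almost every real $y>1$ (with respect to Lebesgue measure), $$\sum_{\substack{1\le k<\ell\le K\\ \lfloor y^k\rfloor\ne\lfloor y^\ell\rfloor\\ \lfloor y^k\rfloor\equiv\lfloor y^\ell\rfloor\pmod 2}}W\bigl(\lfloor y^\ell\rfloor-\lfloor y^k\rfloor\bigr)=\left(\frac{3\zeta(2)}{10\zeta(4)}+o_y(1)\right)K^2$$ as $K\to\infty$ through the positive integers.
   Context: For a nonzero integer $n$, $W(n)=\prod_{p\mid n}(1+1/p)$, the product over primes dividing $n$. $\lfloor x\rfloor$ is the greatest integer not exceeding $x$; $\zeta$ is the Riemann zeta function; $k,\ell$ are integers. $o_y(1)$ denotes a quantity tending to $0$ as $K\to\infty$ for the fixed $y$, at a rate that may depend on $y$. *)

theory Defs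
  imports "HOL-Analysis.Analysis" "HOL-Number_Theory.Number_Theory"
begin

text \<open>The Riemann zeta function on the real half-line \<open>s > 1\<close>, where it is given by its
  Dirichlet series (for \<open>s \<le> 1\<close> the series diverges and the value is meaningless).\<close>

definition zeta :: "real \<Rightarrow> real" where
  "zeta s = (\<Sum>n. 1 / real (Suc n) powr s)"

text \<open>Over the integers, \<^const>\<open>prime\<close> implies positivity, so every prime dividing \<open>n\<close>
  is counted exactly once. Only the values at \<open>n \<noteq> 0\<close> matter.\<close>

definition W :: "int \<Rightarrow> real" where
  "W n = (\<Prod>p | prime p \<and> p dvd n. 1 + 1 / real_of_int p)"

definition index_pairs :: "real \<Rightarrow> nat \<Rightarrow> (nat \<times> nat) set" where
  "index_pairs y K = {(k, l). 1 \<le> k \<and> k < l \<and> l \<le> K \<and>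
     \<lfloor>y ^ k\<rfloor> \<noteq> \<lfloor>y ^ l\<rfloor> \<and> [\<lfloor>y ^ k\<rfloor> = \<lfloor>y ^ l\<rfloor>] (mod 2)}"

end

theory Submission
  imports Defs "HOL-Computational_Algebra.Squarefree" "HOL-Real_Asymp.Real_Asymp"
begin

text \<open>
  Write \<open>a\<^sub>k = \<lfloor>y ^ k\<rfloor>\<close>. For even \<open>n \<noteq> 0\<close> the weight is \<open>W n = 3/2 \<Sum> 1/d\<close>, summed over
  the odd squarefree divisors \<open>d\<close> of \<open>n\<close> (\<open>W_even\<close>), so the sum in question equals \<open>3/2\<close>
  times the sum over odd squarefree \<open>d\<close> of \<open>1/d\<close> times the number of pairs \<open>k < l \<le> K\<close> with
  \<open>a\<^sub>k \<noteq> a\<^sub>l\<close> and \<open>2 d dvd a\<^sub>l - a\<^sub>k\<close> (\<open>W_sum_eq\<close>). If residues modulo \<open>2 d\<close> were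
  equidistributed, that number would be about \<open>K\<^sup>2 / (4 d)\<close>, and the constant \<open>3 \<zeta>(2) / (10 \<zeta>(4))\<close>
  results from \<open>\<Sum> 1/d\<^sup>2 = 4/5 \<zeta>(2)/\<zeta>(4)\<close> (\<open>has_sum_odd_squarefree\<close>).

  Equidistribution itself never has to be proved, because one of the two bounds is free.
  By the Cauchy-Schwarz inequality, among any \<open>K\<close> integers at least \<open>(K\<^sup>2/m - K) / 2\<close> pairs
  are congruent modulo \<open>m\<close> (\<open>congruent_pairs_lower_bound\<close>).
  The excess over this lower bound is therefore a nonnegative function of \<open>y\<close>, and an upper bound
  for its mean over an interval \<open>[a, b)\<close> with \<open>1 < a\<close> controls it almost everywhere.

  Two estimates bound the mean, both uniform in the modulus \<open>m\<close>. Their common source is that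
  a convex increasing function \<open>f\<close> needs no longer to rise from \<open>n + 1\<close> to \<open>n + 2\<close> than it needed
  from \<open>n\<close> to \<open>n + 1\<close>. Hence \<open>\<lfloor>f y\<rfloor>\<close> lies in a given residue class, its first member left aside, for
  at most the share \<open>1/m\<close> of the interval (\<open>emeasure_residue_class_le\<close>).
  Applied to \<open>y ^ l\<close> on each piece where \<open>\<lfloor>y ^ k\<rfloor>\<close> is constant, this shows that
  \<open>m dvd a\<^sub>l - a\<^sub>k\<close> on a set of measure at most \<open>(b - a)/m\<close> plus an error decaying geometrically in
  \<open>l - k\<close> (\<open>measure_congruent_powers_le\<close>). Applied to \<open>y ^ l - y ^ k\<close>, it shows that
  \<open>a\<^sub>l - a\<^sub>k\<close> is a nonzero multiple of \<open>m\<close> on a set of measure at most \<open>2 (b - 1)/m\<close>, with no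
  error term at all (\<open>measure_nonzero_multiple_le\<close>).

  With \<open>m = 2 d\<close>, the first estimate is used for \<open>d \<le> D\<close>, where the finitely many pairs with
  \<open>a\<^sub>k = a\<^sub>l\<close> are negligible, and the second for \<open>d > D\<close>. The mean of the total
  excess is then \<open>O(D K + K\<^sup>2/D)\<close> (\<open>integral_excess\<close>). For \<open>K = j ^ 4\<close> and \<open>D = j\<^sup>2\<close>, this is
  \<open>O(K\<^sup>2/j\<^sup>2)\<close>, which is summable after division by \<open>K\<^sup>2\<close>; hence the normalised excess tends to \<open>0\<close>
  almost everywhere along fourth powers. Since the sum is monotone in \<open>K\<close> and consecutive fourth
  powers have ratio tending to \<open>1\<close>, the limit extends to all \<open>K\<close> (\<open>tendsto_of_fourth_powers\<close>).
\<close>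

section \<open>The weight as a divisor sum\<close>

text \<open>The odd squarefree positive integers: squarefreeness excludes \<open>0\<close>.\<close>
definition odd_squarefree :: "nat set" where
  "odd_squarefree = {d. odd d \<and> squarefree d}"

lemma squarefree_prod_primes:
  fixes S :: "nat set"
  assumes "finite S" "\<And>p. p \<in> S \<Longrightarrow> prime p"
  shows "squarefree (\<Prod>S)"
  by (rule squarefree_prod_coprime[of S "\<lambda>p. p"]) (use assms in \<open>auto intro: primes_coprime squarefree_prime\<close>)

lemma prime_dvd_prod_primes_iff:
  fixes S :: "nat set"
  assumes "finite S" "\<And>p. p \<in> S \<Longrightarrow> prime p" "prime q"
  shows "q dvd \<Prod>S \<longleftrightarrow> q \<in> S"
  using assms by (metis (full_types) dvd_prod_eqI dvd_refl prime_dvd_prod_iff primes_dvd_imp_eq)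

lemma prod_primes_dvd:
  fixes S :: "nat set"
  assumes "finite S" "\<And>p. p \<in> S \<Longrightarrow> prime p \<and> p dvd n"
  shows "\<Prod>S dvd n"
  using assms
proof (induction S rule: finite_induct)
  case (insert p S)
  have "coprime p (\<Prod>S)"
    using insert by (intro prod_coprime_right primes_coprime) auto
  then show ?case
    using insert by (simp add: divides_mult)
qed simp

lemma prod_prime_factors_squarefree:
  fixes d :: nat
  assumes "squarefree d"
  shows "\<Prod>(prime_factors d) = d"
proof -
  have "d \<noteq> 0" using assms by (cases "d = 0") auto
  then have "d = (\<Prod>p\<in>prime_factors d. p ^ multiplicity p d)"
    by (simp add: prime_factorization_nat)
  also have "\<dots> = (\<Prod>p\<in>prime_factors d. p)"
    using squarefree_factorial_semiring'[OF \<open>d \<noteq> 0\<close>] assms by (intro prod.cong) auto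
  finally show ?thesis by simp
qed

text \<open>The prime \<open>2\<close> contributes the factor \<open>3/2\<close>, and expanding the product over the odd primes
  dividing \<open>n\<close> gives the reciprocals of the odd squarefree divisors.\<close>
lemma W_even:
  fixes n :: int
  assumes "n \<noteq> 0" "even n"
  shows "W n = 3 / 2 * (\<Sum>d | d \<in> odd_squarefree \<and> int d dvd n. 1 / real d)"
proof -
  define P where "P = {p::nat. prime p \<and> odd p \<and> int p dvd n}"
  have fin: "finite {p::int. prime p \<and> p dvd n}"
    by (rule finite_subset[OF _ finite_divisors_int[OF assms(1)]]) auto
  have img: "{p::int. prime p \<and> p dvd n} = insert 2 (int ` P)"
  proof (intro equalityI subsetI)
    fix p :: int assume p: "p \<in> {p. prime p \<and> p dvd n}"
    then have "p > 0" using prime_gt_0_int by simp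
    then obtain m where m: "p = int m" by (metis zero_less_imp_eq_int)
    have "p = 2" if "even p"
      using p that primes_dvd_imp_eq[of 2 p] by simp
    then show "p \<in> insert 2 (int ` P)"
      using p unfolding P_def m by auto
  qed (use assms in \<open>auto simp: P_def\<close>)
  have "finite (int ` P)" using fin img by simp
  then have finP: "finite P" by (rule finite_imageD) simp
  have "W n = (\<Prod>p\<in>insert 2 (int ` P). 1 + 1 / real_of_int p)"
    unfolding W_def img ..
  also have "\<dots> = 3 / 2 * (\<Prod>p\<in>int ` P. 1 + 1 / real_of_int p)"
    by (subst prod.insert) (use finP in \<open>auto simp: P_def\<close>)
  also have "(\<Prod>p\<in>int ` P. 1 + 1 / real_of_int p) = (\<Prod>p\<in>P. 1 / real p + 1)"
    by (subst prod.reindex) (auto simp: add.commute)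
  also have "\<dots> = (\<Sum>S\<in>Pow P. 1 / real (\<Prod>S))"
    by (subst prod_add[OF finP]) (simp add: prod_dividef)
  also have "\<dots> = (\<Sum>d | d \<in> odd_squarefree \<and> int d dvd n. 1 / real d)"
  proof (rule sum.reindex_bij_witness[of _ prime_factors Prod])
    fix S assume "S \<in> Pow P"
    then have S: "finite S" "\<And>p. p \<in> S \<Longrightarrow> prime p \<and> odd p \<and> int p dvd n"
      using finP finite_subset by (auto simp: P_def)
    then have pos: "\<Prod>S \<noteq> 0" by (auto dest: prime_gt_0_nat)
    show "prime_factors (\<Prod>S) = S"
      using prime_dvd_prod_primes_iff[of S] S pos by (auto simp: prime_factors_dvd)
    have "int (\<Prod>S) dvd n"
    proof -
      have "(\<Prod>S) dvd nat \<bar>n\<bar>"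
        using S by (intro prod_primes_dvd) (auto simp: dvd_nat_abs_iff)
      then show ?thesis by (simp add: dvd_nat_abs_iff)
    qed
    moreover have "odd (\<Prod>S)" using S by (auto simp: even_prod_iff)
    ultimately show "\<Prod>S \<in> {d. d \<in> odd_squarefree \<and> int d dvd n}"
      using squarefree_prod_primes[of S] S by (auto simp: odd_squarefree_def)
  next
    fix d assume d: "d \<in> {d. d \<in> odd_squarefree \<and> int d dvd n}"
    then show "\<Prod>(prime_factors d) = d"
      by (auto simp: odd_squarefree_def prod_prime_factors_squarefree)
    show "prime_factors d \<in> Pow P"
    proof
      show "prime_factors d \<subseteq> P"
      proof
        fix p assume p: "p \<in> prime_factors d"
        then have "p dvd d" "prime p" by auto
        moreover have "int p dvd n"
          using d \<open>p dvd d\<close> dvd_trans[of "int p" "int d" n] by simp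
        moreover have "odd p"
          using d \<open>p dvd d\<close> by (auto simp: odd_squarefree_def)
        ultimately show "p \<in> P" by (simp add: P_def)
      qed
    qed
  qed auto
  finally show ?thesis .
qed

lemma has_sum_zeta:
  assumes "s > 1"
  shows "((\<lambda>n. 1 / real n ^ s) has_sum zeta s) {1..}"
proof -
  have "summable (\<lambda>n. 1 / real n ^ s)" 
    using inverse_power_summable[of s, where 'a=real] assms by (simp add: field_simps)
  then have "summable (\<lambda>n. 1 / real (Suc n) ^ s)"
    by (subst summable_Suc_iff)
  then have "(\<lambda>n. 1 / real (Suc n) ^ s) sums zeta s"
    unfolding zeta_def by (simp add: powr_realpow summable_sums del: of_nat_Suc)
  then have "((\<lambda>n. 1 / real (Suc n) ^ s) has_sum zeta s) UNIV"
    by (intro sums_nonneg_imp_has_sum) auto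
  also have "?this \<longleftrightarrow> ((\<lambda>n. 1 / real n ^ s) has_sum zeta s) {1..}"
    by (rule has_sum_reindex_bij_witness[of _ "\<lambda>n. n - 1" Suc]) auto
  finally show ?thesis .
qed

text \<open>Sorting the positive integers by their square part factors \<open>\<zeta>(2)\<close> as
  \<open>\<zeta>(4)\<close> times the sum over squarefree \<open>d\<close> of \<open>1/d^2\<close>, and the even
  squarefree numbers contribute a quarter of what the odd ones do.\<close>

lemma has_sum_odd_squarefree:
  "((\<lambda>d. 1 / real d ^ 2) has_sum (4 / 5 * (zeta 2 / zeta 4))) odd_squarefree"
proof -
  define g where "g = (\<lambda>d. 1 / real d ^ 2)"
  define SF where "SF = {d::nat. squarefree d}"
  have pos: "d > 0" if "squarefree d" for d :: nat using that by (cases "d = 0") auto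
  have g: "(g has_sum zeta 2) {1..}"
    using has_sum_zeta[of 2] unfolding g_def by simp
  have sub: "g summable_on X" if "X \<subseteq> {1..}" for X
    using summable_on_subset_banach[of g "{1..}" X] g that has_sum_imp_summable by blast
  define q where "q = infsum g odd_squarefree"
  have q: "(g has_sum q) odd_squarefree"
    unfolding q_def by (rule has_sum_infsum[OF sub]) (auto simp: odd_squarefree_def dest: pos)
  have "(g has_sum (1/4 * q)) ((*) 2 ` odd_squarefree)"
  proof -
    have "((\<lambda>d. 1/4 * g d) has_sum (1/4 * q)) odd_squarefree"
      by (rule has_sum_cmult_right[OF q])
    then have "((g \<circ> (*) 2) has_sum (1/4 * q)) odd_squarefree"
      by (simp add: g_def o_def power_mult_distrib)
    then show ?thesis
      by (subst has_sum_reindex) (auto simp: inj_on_def)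
  qed
  then have "(g has_sum (q + 1/4 * q)) (odd_squarefree \<union> (*) 2 ` odd_squarefree)"
    by (intro has_sum_Un_disjoint[OF q]) (auto simp: odd_squarefree_def)
  also have "odd_squarefree \<union> (*) 2 ` odd_squarefree = SF"
  proof (intro equalityI subsetI)
    fix d assume d: "d \<in> SF"
    show "d \<in> odd_squarefree \<union> (*) 2 ` odd_squarefree"
    proof (cases "even d")
      case True
      then obtain e where e: "d = 2 * e" by auto
      have "odd e"
        using d not_squarefreeI[of 2 d] by (auto simp: SF_def e power2_eq_square)
      moreover have "squarefree e" using d squarefree_mono[of e d] by (simp add: SF_def e)
      ultimately show ?thesis by (auto simp: odd_squarefree_def e)
    qed (use d in \<open>auto simp: odd_squarefree_def SF_def\<close>)
  next
    fix d assume d: "d \<in> odd_squarefree \<union> (*) 2 ` odd_squarefree"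
    have "squarefree (2 * e)" if "odd e" "squarefree e" for e :: nat
      using that squarefree_prime[of "2::nat"] by (intro squarefree_mult_coprime) auto
    then show "d \<in> SF" using d by (auto simp: odd_squarefree_def SF_def)
  qed
  finally have SF: "(g has_sum (5 / 4 * q)) SF" by simp
  have "(g has_sum zeta 2) {1..} \<longleftrightarrow>
        ((\<lambda>(d,m). g d * (1 / real m ^ 4)) has_sum zeta 2) (SF \<times> {1..})"
  proof (rule has_sum_reindex_bij_witness[of _ "\<lambda>(d,m). d * m ^ 2"
        "\<lambda>n. (squarefree_part n, square_part n)"])
    fix n :: nat assume n: "n \<in> {1..}"
    show "(case (squarefree_part n, square_part n) of (d, m) \<Rightarrow> d * m\<^sup>2) = n"
      using squarefree_decompose[of n] by simp
    have "square_part n \<noteq> 0" using n by simp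
    then show "(squarefree_part n, square_part n) \<in> SF \<times> {1..}"
      by (simp add: SF_def Suc_le_eq del: square_part_0_iff)
    have "real n = real (squarefree_part n) * real (square_part n) ^ 2"
      using arg_cong[OF squarefree_decompose[of n], of real] by (simp only: of_nat_mult of_nat_power)
    then show "(case (squarefree_part n, square_part n) of (d, m) \<Rightarrow> g d * (1 / real m ^ 4)) = g n"
      by (simp add: g_def power_mult_distrib)
  next
    fix dm :: "nat \<times> nat" assume "dm \<in> SF \<times> {1..}"
    then obtain d m where dm: "dm = (d, m)" "squarefree d" "m > 0" by (auto simp: SF_def)
    show "(case dm of (d, m) \<Rightarrow> d * m\<^sup>2) \<in> {1..}"
      using dm pos[of d] by (simp add: Suc_le_eq)
    have mult: "multiplicity p (d * m^2) = multiplicity p d + 2 * multiplicity p m"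
      if "prime p" for p
      using that dm pos[of d] by (simp add: prime_elem_multiplicity_mult_distrib prime_elem_multiplicity_power_distrib)
    have le: "multiplicity p d \<le> 1" if "prime p" for p
    proof -
      have "d \<noteq> 0" using pos[OF dm(2)] by simp
      from squarefree_factorial_semiring''[OF this] show ?thesis using dm(2) that by blast
    qed
    have half: "(a + 2 * b) div 2 = b" if "a \<le> 1" for a b :: nat using that by presburger
    have sq: "square_part (d * m^2) = m"
    proof (rule multiplicity_eq_nat)
      fix p :: nat assume p: "prime p"
      show "multiplicity p (square_part (d * m\<^sup>2)) = multiplicity p m"
        by (simp only: prime_multiplicity_square_part[OF p] mult[OF p] half[OF le[OF p]])
    next
      show "square_part (d * m\<^sup>2) > 0"
        using square_part_0_iff[of "d * m\<^sup>2"] dm pos[of d] by (intro gr0I) auto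
    qed (use dm in simp)
    have "d * m^2 = squarefree_part (d * m^2) * m^2"
      using squarefree_decompose[of "d * m^2"] unfolding sq .
    then have sf: "squarefree_part (d * m^2) = d" using dm(3) by simp
    show "(squarefree_part (case dm of (d, m) \<Rightarrow> d * m\<^sup>2),
         square_part (case dm of (d, m) \<Rightarrow> d * m\<^sup>2)) = dm"
      by (simp add: dm(1) sq sf)
  qed simp
  then have prod: "((\<lambda>(d,m). g d * (1 / real m ^ 4)) has_sum zeta 2) (SF \<times> {1..})"
    using g by simp
  have "((\<lambda>d. g d * zeta 4) has_sum zeta 2) SF"
    by (rule has_sum_SigmaD[OF prod]) (use has_sum_cmult_right[OF has_sum_zeta[of 4]] in auto)
  moreover have "((\<lambda>d. g d * zeta 4) has_sum (5 / 4 * q * zeta 4)) SF"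
    by (rule has_sum_cmult_left[OF SF])
  ultimately have eq: "zeta 2 = 5 / 4 * q * zeta 4" by (rule has_sum_unique)
  have "zeta 4 \<noteq> 0"
    using finite_sum_le_has_sum[OF has_sum_zeta[of 4], of "{1}"] by auto
  then have "q = 4 / 5 * (zeta 2 / zeta 4)" using eq by (simp add: field_simps)
  then show ?thesis using q by (simp add: g_def)
qed

section \<open>Residues of convex functions\<close>

lemma fmeasurable_bounded:
  fixes S :: "real set"
  assumes "bounded S" "S \<in> sets borel"
  shows "S \<in> fmeasurable lborel"
  using assms by (intro fmeasurableI emeasure_bounded_finite) auto

lemma level_set_measurable:
  fixes f :: "real \<Rightarrow> real"
  assumes "is_interval I" "continuous_on I f"
  shows "{x \<in> I. \<lfloor>f x\<rfloor> = n} \<in> sets borel"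
proof -
  have I: "I \<in> sets borel" using assms(1) by (rule real_interval_borel_measurable)
  have "f \<in> borel_measurable (restrict_space borel I)"
    using assms(2) by (rule borel_measurable_continuous_on_restrict)
  then have "f -` {of_int n..<of_int n
      + 1} \<inter> space (restrict_space borel I) \<in> sets (restrict_space borel I)"
    by (rule measurable_sets) auto
  then have "f -` {of_int n..<of_int n + 1} \<inter> I \<in> sets borel"
    using I by (simp add: space_restrict_space sets_restrict_space_iff)
  also have "f -` {of_int n..<of_int n + 1} \<inter> I = {x \<in> I. \<lfloor>f x\<rfloor> = n}"
    by (auto simp: floor_eq_iff)
  finally show ?thesis .
qed

text \<open>A convex increasing function crosses \<open>[n + 1, n + 2)\<close> no slower than it crosses
  \<open>[n, n + 1)\<close>, provided that it starts at or below \<open>n\<close>, so that the lower crossing is not cut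
  off by the left end of \<open>I\<close>.\<close>
lemma emeasure_level_set_Suc_le:
  fixes f :: "real \<Rightarrow> real"
  assumes I: "is_interval I" and cont: "continuous_on I f" and conv: "convex_on I f"
    and mono: "strict_mono_on I f" and x: "x \<in> I" "f x \<le> of_int n"
  shows "emeasure lborel {y \<in> I. \<lfloor>f y\<rfloor> = n + 1} \<le> emeasure lborel {y \<in> I. \<lfloor>f y\<rfloor> = n}"
proof (cases "{y \<in> I. \<lfloor>f y\<rfloor> = n + 1} = {}")
  case True
  then show ?thesis unfolding True by simp
next
  case False
  then obtain z where z: "z \<in> I" "\<lfloor>f z\<rfloor> = n + 1" by auto
  have fz: "of_int n + 1 \<le> f z" using z(2) by linarith
  have less: "a < b" if "a \<in> I" "b \<in> I" "f a < f b" for a b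
    using strict_mono_onD[OF mono that(2,1)] that(3) by (cases a b rule: linorder_cases) auto
  have xz: "x < z" by (rule less[OF x(1) z(1)]) (use x(2) fz in linarith)
  have sub: "{x..z} \<subseteq> I" using mem_is_interval_1_I[OF I x(1) z(1)] by auto
  have c: "continuous_on {x..z} f" using cont sub by (rule continuous_on_subset)
  obtain s where s: "x \<le> s" "s \<le> z" "f s = of_int n"
    using IVT'[of f x "of_int n" z] x fz xz c by auto
  obtain p where p: "x \<le> p" "p \<le> z" "f p = of_int n + 1"
    using IVT'[of f x "of_int n + 1" z] x fz xz c by auto
  have sI: "s \<in> I" "p \<in> I" using s p sub by auto
  have sp: "s < p" by (rule less[OF sI]) (simp add: s p)
  \<comment> \<open>Slopes increase: rising from \<open>n\<close> to \<open>n + 1\<close> took the length \<open>p - s\<close>, so the next unit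
     step takes at most as long.\<close>
  have "{y \<in> I. \<lfloor>f y\<rfloor> = n + 1} \<subseteq> {p..p + (p - s)}"
  proof
    fix y assume "y \<in> {y \<in> I. \<lfloor>f y\<rfloor> = n + 1}"
    then have y: "y \<in> I" "of_int n + 1 \<le> f y" "f y < of_int n + 2"
      by (auto simp: floor_eq_iff)
    have py: "p \<le> y" using strict_mono_onD[OF mono y(1) sI(2)] y(2) p(3) by linarith
    have "y - p \<le> p - s" if "p < y"
    proof -
      have "(f s - f p) / (s - p) \<le> (f p - f y) / (p - y)"
        using convex_on_slope_le[OF conv sI(1) y(1) sp that] by linarith
      then have "1 / (p - s) \<le> (f y - f p) / (y - p)"
        using s p sp that by (simp add: field_simps)
      also have "\<dots> \<le> 1 / (y - p)"
        using y p that by (intro divide_right_mono) auto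
      finally show ?thesis using sp that by (simp add: field_simps)
    qed
    then show "y \<in> {p..p + (p - s)}" using py sp by (cases "p < y") auto
  qed
  then have "emeasure lborel {y \<in> I. \<lfloor>f y\<rfloor> = n + 1} \<le> emeasure lborel {p..p + (p - s)}"
    by (rule emeasure_mono) simp
  also have "\<dots> = emeasure lborel {s..<p}" using sp by simp
  also have "\<dots> \<le> emeasure lborel {y \<in> I. \<lfloor>f y\<rfloor> = n}"
  proof (rule emeasure_mono)
    show "{s..<p} \<subseteq> {y \<in> I. \<lfloor>f y\<rfloor> = n}"
    proof
      fix y assume y: "y \<in> {s..<p}"
      then have yI: "y \<in> I" using s p sub by auto
      have "f s \<le> f y" using strict_mono_onD[OF mono sI(1) yI] y by (cases "s = y") auto
      moreover have "f y < f p" using strict_mono_onD[OF mono yI sI(2)] y by auto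
      ultimately show "y \<in> {y \<in> I. \<lfloor>f y\<rfloor> = n}"
        using yI s p by (auto simp: floor_eq_iff)
    qed
  next
    show "{y \<in> I. \<lfloor>f y\<rfloor> = n} \<in> sets lborel"
      unfolding sets_lborel by (rule level_set_measurable[OF I cont])
  qed
  finally show ?thesis .
qed

text \<open>Shifting each level set of the class of \<open>r\<close> down by \<open>q\<close> levels does not decrease
  its measure. The \<open>m\<close> shifted families are disjoint, so the class has at most the
  share \<open>1/m\<close> of \<open>I\<close>. The bound \<open>r \<ge> N + m - 1\<close> on the first level keeps all shifts in the range
  where the previous lemma applies.\<close>
lemma emeasure_residue_class_le:
  fixes f :: "real \<Rightarrow> real"
  assumes I: "is_interval I" and cont: "continuous_on I f" and conv: "convex_on I f"
    and mono: "strict_mono_on I f" and x: "x \<in> I" "f x \<le> of_int N"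
    and m: "m > 0" and r: "r \<ge> N + int m - 1"
  shows "of_nat m * emeasure lborel (\<Union>i. {y \<in> I. \<lfloor>f y\<rfloor> = r + int m * int i}) \<le> emeasure lborel I"
proof -
  define A where "A n = {y \<in> I. \<lfloor>f y\<rfloor> = n}" for n
  have A [measurable]: "A n \<in> sets borel" for n
    unfolding A_def by (rule level_set_measurable[OF I cont])
  have disj: "disjoint_family (\<lambda>i::nat. A (r + int m * int i - q))" for q
    using m by (auto simp: disjoint_family_on_def A_def)
  have step: "emeasure lborel (A (n + int q)) \<le> emeasure lborel (A n)" if "N \<le> n" for n q
  proof (induction q)
    case 0
    show ?case by simp
  next
    case (Suc q)
    have "f x \<le> of_int (n + int q)" using x that by linarith
    then have "emeasure lborel (A (n + int q + 1)) \<le> emeasure lborel (A (n + int q))"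
      unfolding A_def by (intro emeasure_level_set_Suc_le[OF I cont conv mono x(1)])
    then show ?case using Suc by (simp add: algebra_simps)
  qed
  define E where "E q = (\<Union>i. A (r + int m * int i - int q))" for q :: nat
  have E [measurable]: "E q \<in> sets borel" for q unfolding E_def by measurable
  have le: "emeasure lborel (E 0) \<le> emeasure lborel (E q)" if "q < m" for q
  proof -
    have "emeasure lborel (E 0) = (\<Sum>i. emeasure lborel (A (r + int m * int i)))"
      unfolding E_def using disj[of 0] by (subst suminf_emeasure) auto
    also have "\<dots> \<le> (\<Sum>i. emeasure lborel (A (r + int m * int i - int q)))"
    proof (intro suminf_le)
      fix i
      have "0 \<le> int m * int i" by simp
      then have "N \<le> r + int m * int i - int q" using r that by linarith
      from step[OF this, of q]
      show "emeasure lborel (A (r + int m * int i))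
          \<le> emeasure lborel (A (r + int m * int i - int q))"
        by simp
    qed (rule summableI)+
    also have "\<dots> = emeasure lborel (E q)"
      unfolding E_def using disj[of "int q"] by (subst suminf_emeasure) auto
    finally show ?thesis .
  qed
  have "disjoint_family_on E {..<m}"
  proof (unfold disjoint_family_on_def, intro ballI impI, rule ccontr)
    fix p q
    assume pq: "p \<in> {..<m}" "q \<in> {..<m}" "p \<noteq> q" and "E p \<inter> E q \<noteq> {}"
    then obtain y where y: "y \<in> E p" "y \<in> E q" by auto
    obtain i where i: "\<lfloor>f y\<rfloor> = r + int m * int i - int p" using y(1) by (auto simp: E_def A_def)
    obtain j where j: "\<lfloor>f y\<rfloor> = r + int m * int j - int q" using y(2) by (auto simp: E_def A_def)
    from i j have "int p - int q = int m * (int i - int j)" by (simp add: algebra_simps)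
    then have "int m dvd int p - int q" by simp
    then have "int m \<le> \<bar>int p - int q\<bar>"
      using dvd_imp_le_int[of "int p - int q" "int m"] pq by simp
    then show False using pq by auto
  qed
  then have "(\<Sum>q<m. emeasure lborel (E q)) = emeasure lborel (\<Union>q<m. E q)"
    by (intro sum_emeasure) auto
  also have "\<dots> \<le> emeasure lborel I"
    using real_interval_borel_measurable[OF I] by (intro emeasure_mono) (auto simp: E_def A_def)
  finally have "(\<Sum>q<m. emeasure lborel (E q)) \<le> emeasure lborel I" .
  moreover have "of_nat m * emeasure lborel (E 0) = (\<Sum>q<m. emeasure lborel (E 0))" by simp
  moreover have "(\<Sum>q<m. emeasure lborel (E 0)) \<le> (\<Sum>q<m. emeasure lborel (E q))"
    by (intro sum_mono le) auto
  ultimately show ?thesis unfolding E_def A_def by simp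
qed

lemma measure_residue_class_le:
  fixes f :: "real \<Rightarrow> real"
  assumes I: "is_interval I" "bounded I" and cont: "continuous_on I f" and conv: "convex_on I f"
    and mono: "strict_mono_on I f" and x: "x \<in> I" "f x \<le> of_int N"
    and m: "m > 0" and r: "r \<ge> N + int m - 1"
  shows "measure lborel (\<Union>i. {y \<in> I. \<lfloor>f y\<rfloor> = r + int m * int i}) \<le> measure lborel I / real m"
    (is "measure lborel ?U \<le> _")
proof -
  have fin: "emeasure lborel S = ennreal (measure lborel S)" if "S \<subseteq> I" for S
    using emeasure_bounded_finite[OF bounded_subset[OF I(2) that]]
    by (simp add: emeasure_eq_ennreal_measure)
  have "ennreal (real m * measure lborel ?U) = of_nat m * emeasure lborel ?U"
    by (subst fin) (auto simp: ennreal_mult ennreal_of_nat_eq_real_of_nat)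
  also have "\<dots> \<le> emeasure lborel I"
    by (rule emeasure_residue_class_le[OF I(1) cont conv mono x m r])
  also have "\<dots> = ennreal (measure lborel I)" by (rule fin) simp
  finally have "real m * measure lborel ?U \<le> measure lborel I"
    by (simp add: ennreal_le_iff)
  then show ?thesis using m by (simp add: field_simps)
qed

lemma measure_le_diameter:
  fixes S :: "real set"
  assumes "d \<ge> 0" "\<And>x y. x \<in> S \<Longrightarrow> y \<in> S \<Longrightarrow> y - x \<le> d"
  shows "measure lborel S \<le> d"
proof (cases "S \<in> sets lborel \<and> S \<noteq> {}")
  case True
  then obtain z where z: "z \<in> S" by auto
  have bdd: "bdd_below S"
    by (rule bdd_belowI[of _ "z - d"]) (use assms(2)[OF _ z] in force)
  have "S \<subseteq> {Inf S..Inf S + d}"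
  proof
    fix y assume y: "y \<in> S"
    have "y - d \<le> Inf S"
      using assms(2)[OF _ y] True by (intro cInf_greatest) force+
    then show "y \<in> {Inf S..Inf S + d}" using cInf_lower[OF y bdd] by simp
  qed
  then have "measure lborel S \<le> measure lborel {Inf S..Inf S + d}"
    using True by (intro measure_mono_fmeasurable fmeasurableI) auto
  then show ?thesis using assms(1) by simp
qed (use assms(1) in \<open>auto simp: measure_notin_sets\<close>)

text \<open>Here the whole residue class is counted. At most one of its level sets lies among the first
  \<open>m\<close> levels, where the shifting argument is not available; the lower bound \<open>c\<close> on the slope
  bounds its length by \<open>1/c\<close>.\<close>
lemma measure_congruent_le:
  fixes f :: "real \<Rightarrow> real"
  assumes I: "is_interval I" "bounded I" and cont: "continuous_on I f" and conv: "convex_on I f"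
    and nonneg: "\<And>y. y \<in> I \<Longrightarrow> f y \<ge> 0"
    and c: "c > 0" "\<And>x y. x \<in> I \<Longrightarrow> y \<in> I \<Longrightarrow> x \<le> y \<Longrightarrow> c * (y - x) \<le> f y - f x"
    and m: "m > 0"
  shows "measure lborel {y \<in> I. int m dvd \<lfloor>f y\<rfloor> - j} \<le> measure lborel I / real m + 1 / c"
proof (cases "I = {}")
  case True
  then show ?thesis using c(1) by simp
next
  case False
  have mono: "strict_mono_on I f"
  proof (rule strict_mono_onI)
    fix x y assume xy: "x \<in> I" "y \<in> I" "x < y"
    then have "0 < c * (y - x)" using c(1) by simp
    also have "\<dots> \<le> f y - f x" using c(2)[OF xy(1,2)] xy(3) by simp
    finally show "f x < f y" by simp
  qed
  obtain x0 where x0: "x0 \<in> I" "\<And>y. y \<in> I \<Longrightarrow> nat \<lfloor>f x0\<rfloor> \<le> nat \<lfloor>f y\<rfloor>"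
    using ex_has_least_nat[of "\<lambda>x. x \<in> I" _ "\<lambda>x. nat \<lfloor>f x\<rfloor>"] False by blast
  define n0 where "n0 = \<lfloor>f x0\<rfloor>"
  have least: "n0 \<le> \<lfloor>f y\<rfloor>" if "y \<in> I" for y
    using x0(2)[OF that] nonneg[OF that] nonneg[OF x0(1)] by (simp add: n0_def nat_le_eq_zle)
  \<comment> \<open>The smallest level in the residue class of \<open>j\<close> that is not below the lowest level \<open>n0\<close>.\<close>
  define s where "s = n0 + (j - n0) mod int m"
  have s: "n0 \<le> s" "s < n0 + int m" using m by (simp_all add: s_def)
  have sj: "int m dvd j - s"
    by (metis s_def diff_diff_eq minus_mod_eq_mult_div dvd_triv_left)
  define A where "A n = {y \<in> I. \<lfloor>f y\<rfloor> = n}" for n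
  define U where "U = (\<Union>i. A (s + int m + int m * int i))"
  have A [measurable]: "A n \<in> sets borel" for n
    unfolding A_def by (rule level_set_measurable[OF I(1) cont])
  have U [measurable]: "U \<in> sets borel" unfolding U_def by measurable
  have fm: "S \<in> fmeasurable lborel" if "S \<subseteq> I" "S \<in> sets borel" for S
    by (rule fmeasurable_bounded[OF bounded_subset[OF I(2) that(1)] that(2)])
  have [simp]: "A s \<in> fmeasurable lborel" by (rule fm[OF _ A]) (auto simp: A_def)
  have [simp]: "U \<in> fmeasurable lborel" by (rule fm[OF _ U]) (auto simp: U_def A_def)
  have sub: "{y \<in> I. int m dvd \<lfloor>f y\<rfloor> - j} \<subseteq> A s \<union> U"
  proof
    fix y assume y: "y \<in> {y \<in> I. int m dvd \<lfloor>f y\<rfloor> - j}"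
    then have "int m dvd \<lfloor>f y\<rfloor> - j + (j - s)" using sj by (intro dvd_add) auto
    then obtain q where "\<lfloor>f y\<rfloor> - s = int m * q" by (auto elim: dvdE)
    then have q: "\<lfloor>f y\<rfloor> = s + int m * q" by simp
    have "n0 < n0 + int m * (q + 1)" using least[of y] y s(2) q by (simp add: algebra_simps)
    then have "0 < int m * (q + 1)" by simp
    then have "q \<ge> 0" using m by (simp add: zero_less_mult_iff)
    show "y \<in> A s \<union> U"
    proof (cases "q = 0")
      case True
      then show ?thesis using q y by (simp add: A_def)
    next
      case False
      then obtain i where i: "q = 1 + int i" using that[of "nat (q - 1)"] \<open>q \<ge> 0\<close> by simp
      have "\<lfloor>f y\<rfloor> = s + int m + int m * int i"
        unfolding q i by (simp add: distrib_left)
      then show ?thesis using y by (auto simp: U_def A_def)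
    qed
  qed
  have "{y \<in> I. int m dvd \<lfloor>f y\<rfloor> - j} = (\<Union>n\<in>{n. int m dvd n - j}. A n)"
    by (auto simp: A_def)
  then have meas: "{y \<in> I. int m dvd \<lfloor>f y\<rfloor> - j} \<in> sets borel"
    by (simp add: sets.countable_UN'')
  have "measure lborel {y \<in> I. int m dvd \<lfloor>f y\<rfloor> - j} \<le> measure lborel (A s \<union> U)"
    using sub meas by (intro measure_mono_fmeasurable) auto
  also have "\<dots> \<le> measure lborel (A s) + measure lborel U"
    by (rule measure_Un_le) auto
  also have "measure lborel (A s) \<le> 1 / c"
  proof (rule measure_le_diameter)
    fix x y assume xy: "x \<in> A s" "y \<in> A s"
    show "y - x \<le> 1 / c"
    proof (cases "x \<le> y")
      case True
      have "c * (y - x) \<le> f y - f x" using c(2) xy True by (simp add: A_def)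
      also have "\<dots> \<le> 1" using xy by (simp add: A_def) linarith
      finally show ?thesis using c(1) by (simp add: field_simps)
    next
      case False
      then have "y - x \<le> 0" by simp
      also have "0 \<le> 1 / c" using c(1) by simp
      finally show ?thesis .
    qed
  qed (use c(1) in simp)
  also have "measure lborel U \<le> measure lborel I / real m"
  proof -
    have "f x0 \<le> of_int (n0 + 1)" by (simp add: n0_def)
    from measure_residue_class_le[OF I cont conv mono x0(1) this m, of "s + int m"]
    show ?thesis using s(1) by (simp add: U_def A_def)
  qed
  finally show ?thesis by simp
qed

lemma power_diff_ge:
  fixes x y :: real
  assumes "0 \<le> x" "x \<le> y"
  shows "real l * x ^ (l - 1) * (y - x) \<le> y ^ l - x ^ l"
proof (cases l)
  case (Suc n)
  have "real l * x ^ (l - 1) = (\<Sum>p<Suc n. x ^ n)" using Suc by simp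
  also have "\<dots> \<le> (\<Sum>p<Suc n. y ^ p * x ^ (n - p))"
  proof (rule sum_mono)
    fix p assume "p \<in> {..<Suc n}"
    then have "x ^ n = x ^ p * x ^ (n - p)" by (simp flip: power_add)
    also have "\<dots> \<le> y ^ p * x ^ (n - p)"
      using assms by (intro mult_right_mono power_mono) auto
    finally show "x ^ n \<le> y ^ p * x ^ (n - p)" .
  qed
  finally have "(y - x) * (real l * x ^ (l - 1)) \<le> (y - x) * (\<Sum>p<Suc n. y ^ p * x ^ (n - p))"
    using assms by (intro mult_left_mono) auto
  also have "\<dots> = y ^ Suc n - x ^ Suc n" by (rule diff_power_eq_sum[symmetric])
  finally show ?thesis using Suc by (simp add: mult.commute)
qed simp

lemma convex_on_power_diff:
  assumes "k \<le> l"
  shows "convex_on {1::real..<b} (\<lambda>y. y ^ l - y ^ k)"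
proof (rule f''_ge0_imp_convex)
  fix y :: real assume y: "y \<in> {1..<b}"
  show "((\<lambda>y. y ^ l - y ^ k) has_real_derivative (real l * y ^ (l - 1)
      - real k * y ^ (k - 1))) (at y)"
    by (auto intro!: derivative_eq_intros)
  show "((\<lambda>y. real l * y ^ (l - 1) - real k * y ^ (k - 1)) has_real_derivative
     (real l * (real (l - 1) * y ^ (l - 1 - 1)) - real k * (real (k - 1) * y ^ (k - 1 - 1)))) (at y)"
    by (auto intro!: derivative_eq_intros)
  have "y ^ (k - 1 - 1) \<le> y ^ (l - 1 - 1)"
    using y assms by (intro power_increasing) auto
  then have "real k * (real (k - 1) * y ^ (k - 1 - 1)) \<le> real l * (real (l - 1) * y ^ (l - 1 - 1))"
    using assms y by (intro mult_mono) auto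
  then show "real l * (real (l - 1) * y ^ (l - 1 - 1))
      - real k * (real (k - 1) * y ^ (k - 1 - 1)) \<ge> 0"
    by simp
qed simp

lemma strict_mono_on_power_diff:
  assumes "1 \<le> k" "k < l"
  shows "strict_mono_on {1::real..<b} (\<lambda>y. y ^ l - y ^ k)"
proof (rule strict_mono_onI)
  fix x y :: real assume xy: "x \<in> {1..<b}" "y \<in> {1..<b}" "x < y"
  have eq: "z ^ l - z ^ k = z ^ k * (z ^ (l - k) - 1)" for z :: real
    using assms by (simp add: algebra_simps flip: power_add)
  have "x ^ k * (x ^ (l - k) - 1) \<le> y ^ k * (x ^ (l - k) - 1)"
    using xy by (intro mult_right_mono power_mono) auto
  also have "\<dots> < y ^ k * (y ^ (l - k) - 1)"
    using xy assms by (intro mult_strict_left_mono) (auto intro!: power_strict_mono)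
  finally show "x ^ l - x ^ k < y ^ l - y ^ k" by (simp add: eq)
qed

text \<open>The floor of \<open>y ^ l - y ^ k\<close> differs from \<open>\<lfloor>y ^ l\<rfloor> - \<lfloor>y ^ k\<rfloor>\<close> by at most one, so only the
  residue classes of \<open>0\<close> and \<open>-1\<close> matter. Since \<open>y ^ l - y ^ k\<close> vanishes at \<open>1\<close>, starting there
  costs no boundary term: a positive multiple of \<open>m\<close> is at least \<open>m\<close>.\<close>
lemma measure_nonzero_multiple_le:
  fixes b :: real
  assumes kl: "1 \<le> k" "k < l" and m: "m > 0" and b: "b > 1"
  shows "measure lborel {y \<in> {1..<b}. \<lfloor>y ^ k\<rfloor> \<noteq> \<lfloor>y ^ l\<rfloor> \<and> int m dvd \<lfloor>y ^ l\<rfloor> - \<lfloor>y ^ k\<rfloor>}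
           \<le> 2 * (b - 1) / real m"
proof -
  define f where "f y = y ^ l - y ^ k" for y :: real
  define A where "A n = {y \<in> {1..<b}. \<lfloor>f y\<rfloor> = n}" for n
  define U where "U r = (\<Union>i. A (r + int m * int i))" for r
  have I: "is_interval {1..<b}" "bounded {1..<b}" by (auto simp: is_interval_co)
  have cont: "continuous_on {1..<b} f" unfolding f_def by (intro continuous_intros)
  have conv: "convex_on {1..<b} f" unfolding f_def using kl by (intro convex_on_power_diff) auto
  have mono: "strict_mono_on {1..<b} f" unfolding f_def by (rule strict_mono_on_power_diff[OF kl])
  have A [measurable]: "A n \<in> sets borel" for n
    unfolding A_def by (rule level_set_measurable[OF I(1) cont])
  have U_meas [measurable]: "U r \<in> sets borel" for r unfolding U_def by measurable
  have fm: "U r \<in> fmeasurable lborel" for r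
    by (rule fmeasurable_bounded[OF bounded_subset[OF I(2)] U_meas]) (auto simp: U_def A_def)
  have U: "measure lborel (U r) \<le> (b - 1) / real m" if "r \<ge> int m - 1" for r
    using measure_residue_class_le[OF I cont conv mono, of 1 0 m r] b m that
    by (simp add: U_def A_def f_def)
  have "{y \<in> {1..<b}. \<lfloor>y ^ k\<rfloor> \<noteq> \<lfloor>y ^ l\<rfloor> \<and> int m dvd \<lfloor>y ^ l\<rfloor> - \<lfloor>y ^ k\<rfloor>} \<subseteq> U (int m) \<union> U (int m - 1)"
  proof
    fix y assume y: "y \<in> {y \<in> {1..<b}. \<lfloor>y ^ k\<rfloor> \<noteq> \<lfloor>y ^ l\<rfloor> \<and> int m dvd \<lfloor>y ^ l\<rfloor> - \<lfloor>y ^ k\<rfloor>}"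
    then obtain q where q: "\<lfloor>y ^ l\<rfloor> - \<lfloor>y ^ k\<rfloor> = int m * q" by (auto elim: dvdE)
    have "\<lfloor>y ^ k\<rfloor> \<le> \<lfloor>y ^ l\<rfloor>" using y kl by (intro floor_mono power_increasing) auto
    then have "0 < int m * q" using y q by auto
    then have "q > 0" using m by (simp add: zero_less_mult_iff)
    then obtain i where i: "q = 1 + int i" using that[of "nat (q - 1)"] by simp
    have q': "\<lfloor>y ^ l\<rfloor> - \<lfloor>y ^ k\<rfloor> = int m + int m * int i"
      unfolding q i by (simp add: distrib_left)
    have "\<lfloor>f y\<rfloor> = \<lfloor>y ^ l\<rfloor> - \<lfloor>y ^ k\<rfloor> \<or> \<lfloor>f y\<rfloor> = \<lfloor>y ^ l\<rfloor> - \<lfloor>y ^ k\<rfloor> - 1"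
      unfolding f_def by linarith
    then have "\<lfloor>f y\<rfloor> = int m + int m * int i \<or> \<lfloor>f y\<rfloor> = int m - 1 + int m * int i"
      unfolding q' by auto
    then show "y \<in> U (int m) \<union> U (int m - 1)" using y by (auto simp: U_def A_def)
  qed
  then have "measure lborel {y \<in> {1..<b}. \<lfloor>y ^ k\<rfloor> \<noteq> \<lfloor>y ^ l\<rfloor> \<and> int m dvd \<lfloor>y ^ l\<rfloor> - \<lfloor>y ^ k\<rfloor>}
      \<le> measure lborel (U (int m) \<union> U (int m - 1))"
    using fm by (intro measure_mono_fmeasurable) auto
  also have "\<dots> \<le> measure lborel (U (int m)) + measure lborel (U (int m - 1))"
    by (rule measure_Un_le) auto
  also have "\<dots> \<le> (b - 1) / real m + (b - 1) / real m"
    by (intro add_mono U) auto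
  finally show ?thesis by (simp add: field_simps)
qed


lemma harm_le_ln:
  assumes "n > 0"
  shows "harm n \<le> 1 + ln (real n)"
proof -
  have "harm (Suc (n - 1)) - ln (real (Suc (n - 1))) \<le> harm (Suc 0) - ln (real (Suc 0))"
    using decseq_harm_diff_ln by (rule decseqD) simp
  then show ?thesis using assms by (simp add: harm_expand)
qed

text \<open>The interval is cut into the pieces \<open>I j\<close> where \<open>\<lfloor>y ^ k\<rfloor> = j\<close>. On \<open>I j\<close> the
  slope of \<open>y ^ l\<close> is at least \<open>l j a ^ (l - 1 - k)\<close>, so the boundary terms add up to
  a harmonic sum of length \<open>b ^ k\<close>; its logarithm of size \<open>k ln b\<close> is absorbed by the factor \<open>l\<close>.\<close>
lemma measure_congruent_powers_le:
  fixes a b :: real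
  assumes ab: "1 < a" "a < b" and kl: "1 \<le> k" "k < l" and m: "m > 0"
  shows "measure lborel {y \<in> {a..<b}. int m dvd \<lfloor>y ^ l\<rfloor> - \<lfloor>y ^ k\<rfloor>}
           \<le> (b - a) / real m + (1 + ln b) / a ^ (l - 1 - k)"
proof -
  define J where "J = nat \<lfloor>b ^ k\<rfloor>"
  define I where "I j = {y \<in> {a..<b}. \<lfloor>y ^ k\<rfloor> = int j}" for j
  define E where "E j = {y \<in> I j. int m dvd \<lfloor>y ^ l\<rfloor> - int j}" for j
  have bk: "1 \<le> b ^ k" using ab by (intro one_le_power) auto
  have J: "J > 0" "real J \<le> b ^ k" using bk by (auto simp: J_def) 
  have interval: "is_interval (I j)" for j
    unfolding is_interval_1
  proof (intro ballI allI impI)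
    fix x y z assume xy: "x \<in> I j" "y \<in> I j" and z: "x \<le> z \<and> z \<le> y"
    have "x ^ k \<le> z ^ k" "z ^ k \<le> y ^ k"
      using xy z ab by (auto simp: I_def intro!: power_mono)
    then have "\<lfloor>x ^ k\<rfloor> \<le> \<lfloor>z ^ k\<rfloor>" "\<lfloor>z ^ k\<rfloor> \<le> \<lfloor>y ^ k\<rfloor>"
      by (simp_all add: floor_mono)
    then show "z \<in> I j" using xy z by (auto simp: I_def)
  qed
  have [measurable]: "I j \<in> sets borel" for j
    by (rule real_interval_borel_measurable[OF interval])
  have bounded: "bounded (I j)" for j
    by (rule bounded_subset[of "{a..<b}"]) (auto simp: I_def)
  have E_meas [measurable]: "E j \<in> sets borel" for j
    unfolding E_def by measurable
  have fm: "E j \<in> fmeasurable lborel" for j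
    by (rule fmeasurable_bounded[OF bounded_subset[OF bounded] E_meas]) (auto simp: E_def)
  have piece: "measure lborel (E j)
      \<le> measure lborel (I j) / real m + 1 / (real l * real j * a ^ (l - 1 - k))"
    if "j \<in> {1..J}" for j
    unfolding E_def
  proof (rule measure_congruent_le[OF interval bounded _ _ _ _ _ m])
    show "continuous_on (I j) (\<lambda>y. y ^ l)" by (intro continuous_intros)
    have "convex_on {0..} (\<lambda>y::real. y ^ l)" 
      by (cases "even l") (auto intro: convex_power_odd convex_on_subset[OF convex_power_even])
    then show "convex_on (I j) (\<lambda>y. y ^ l)"
      by (rule convex_on_subset) (use ab interval is_interval_convex in \<open>auto simp: I_def\<close>)
    show "0 \<le> y ^ l" if "y \<in> I j" for y using that ab by (auto simp: I_def)
    show "0 < real l * real j * a ^ (l - 1 - k)" using that kl ab by auto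
    fix x y assume xy: "x \<in> I j" "y \<in> I j" "x \<le> y"
    have x: "a \<le> x" "real j \<le> x ^ k" using xy(1) by (auto simp: I_def floor_eq_iff)
    have "real l * real j * a ^ (l - 1 - k) * (y - x)
        \<le> real l * (x ^ k * x ^ (l - 1 - k)) * (y - x)"
      unfolding mult.assoc using x xy ab
      by (intro mult_left_mono mult_mono power_mono) auto
    also have "x ^ k * x ^ (l - 1 - k) = x ^ (l - 1)"
      using kl by (simp flip: power_add)
    also have "real l * x ^ (l - 1) * (y - x) \<le> y ^ l - x ^ l"
      using x xy ab by (intro power_diff_ge) auto
    finally show "real l * real j * a ^ (l - 1 - k) * (y - x) \<le> y ^ l - x ^ l" .
  qed
  have "{y \<in> {a..<b}. int m dvd \<lfloor>y ^ l\<rfloor> - \<lfloor>y ^ k\<rfloor>} \<subseteq> (\<Union>j\<in>{1..J}. E j)"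
  proof
    fix y assume y: "y \<in> {y \<in> {a..<b}. int m dvd \<lfloor>y ^ l\<rfloor> - \<lfloor>y ^ k\<rfloor>}"
    have y1: "1 \<le> y ^ k" using y ab by (intro one_le_power) auto
    then have "\<lfloor>y ^ k\<rfloor> = int (nat \<lfloor>y ^ k\<rfloor>)" by simp
    moreover have "nat \<lfloor>y ^ k\<rfloor> \<le> J"
      unfolding J_def using y ab by (intro nat_mono floor_mono power_mono) auto
    moreover have "1 \<le> nat \<lfloor>y ^ k\<rfloor>" using y1 by (simp add: le_nat_iff)
    ultimately show "y \<in> (\<Union>j\<in>{1..J}. E j)"
      using y by (intro UN_I[of "nat \<lfloor>y ^ k\<rfloor>"]) (auto simp: E_def I_def)
  qed
  moreover have "{y \<in> {a..<b}. int m dvd \<lfloor>y ^ l\<rfloor> - \<lfloor>y ^ k\<rfloor>} \<in> sets lborel" by measurable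
  moreover have "(\<Union>j\<in>{1..J}. E j) \<in> fmeasurable lborel"
    by (rule fmeasurable.finite_UN) (use fm in auto)
  ultimately have "measure lborel {y \<in> {a..<b}. int m dvd \<lfloor>y ^ l\<rfloor> - \<lfloor>y ^ k\<rfloor>}
      \<le> measure lborel (\<Union>j\<in>{1..J}. E j)"
    by (rule measure_mono_fmeasurable)
  also have "\<dots> \<le> (\<Sum>j\<in>{1..J}. measure lborel (E j))"
    by (rule measure_UNION_le) auto
  also have "\<dots> \<le> (\<Sum>j\<in>{1..J}. measure lborel (I j) / real m
      + 1 / (real l * real j * a ^ (l - 1 - k)))"
    by (intro sum_mono piece)
  also have "\<dots> = (\<Sum>j\<in>{1..J}. measure lborel (I j)) / real m + harm J / (real l * a ^ (l - 1 - k))"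
    by (simp add: sum.distrib sum_divide_distrib harm_def field_simps)
  also have "(\<Sum>j\<in>{1..J}. measure lborel (I j)) = measure lborel (\<Union>j\<in>{1..J}. I j)"
    using emeasure_bounded_finite[OF bounded]
    by (intro measure_finite_Union[symmetric]) (auto simp: disjoint_family_on_def I_def less_top)
  also have "\<dots> \<le> measure lborel {a..<b}"
    by (intro measure_mono_fmeasurable fmeasurable_bounded) (auto simp: I_def)
  also have "measure lborel {a..<b} = b - a" using ab by simp
  also have "harm J / (real l * a ^ (l - 1 - k)) \<le> (1 + ln b) / a ^ (l - 1 - k)"
  proof -
    have "harm J \<le> 1 + ln (real J)" by (rule harm_le_ln[OF J(1)])
    also have "ln (real J) \<le> ln (b ^ k)" using J by simp
    also have "\<dots> = real k * ln b" using ab by (simp add: ln_realpow)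
    also have "1 + real k * ln b \<le> real l * 1 + real l * ln b"
      using kl ab by (intro add_mono mult_right_mono) auto
    finally have "harm J \<le> real l * (1 + ln b)" by (simp add: algebra_simps)
    then show ?thesis using kl ab by (simp add: field_simps)
  qed
  finally show ?thesis using m by (simp add: divide_right_mono)
qed

section \<open>Counting congruent pairs\<close>

text \<open>The index pairs \<open>1 \<le> k < l \<le> K\<close>.\<close>
definition pairs :: "nat \<Rightarrow> (nat \<times> nat) set" where
  "pairs K = {(k, l). 1 \<le> k \<and> k < l \<and> l \<le> K}"

text \<open>The reals \<open>y\<close> for which the floors of \<open>y ^ k\<close> and \<open>y ^ l\<close> are congruent modulo \<open>m\<close>: a set
  of \<open>y\<close> for a fixed pair of indices, since it is going to be measured.\<close>
definition congruent_set :: "nat \<Rightarrow> nat \<times> nat \<Rightarrow> real set" where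
  "congruent_set m = (\<lambda>(k, l). {y. int m dvd \<lfloor>y ^ l\<rfloor> - \<lfloor>y ^ k\<rfloor>})"

text \<open>The reals \<open>y\<close> for which the floors of \<open>y ^ k\<close> and \<open>y ^ l\<close> are distinct.\<close>
definition distinct_set :: "nat \<times> nat \<Rightarrow> real set" where
  "distinct_set = (\<lambda>(k, l). {y. \<lfloor>y ^ k\<rfloor> \<noteq> \<lfloor>y ^ l\<rfloor>})"

text \<open>The number of index pairs with floors congruent modulo \<open>m\<close>, written as a sum of indicators
  to make its dependence on \<open>y\<close> easy to integrate.\<close>
definition congruent_count :: "nat \<Rightarrow> nat \<Rightarrow> real \<Rightarrow> real" where
  "congruent_count m K y = (\<Sum>p\<in>pairs K. indicator (congruent_set m p) y)"

text \<open>The number of index pairs with floors that are congruent modulo \<open>m\<close> but distinct.\<close>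
definition distinct_count :: "nat \<Rightarrow> nat \<Rightarrow> real \<Rightarrow> real" where
  "distinct_count m K y = (\<Sum>p\<in>pairs K. indicator (congruent_set m p \<inter> distinct_set p) y)"

lemma finite_pairs [simp]: "finite (pairs K)"
  by (rule finite_subset[of _ "{..K} \<times> {..K}"]) (auto simp: pairs_def)

lemma sum_pairs_eq: "(\<Sum>p\<in>pairs K. f p) = (\<Sum>k=1..K. \<Sum>l\<in>{k<..K}. f (k, l))"
proof -
  have "pairs K = Sigma {1..K} (\<lambda>k. {k<..K})" by (auto simp: pairs_def)
  then show ?thesis by (simp add: sum.Sigma)
qed

lemma sum_square_split:
  fixes f :: "nat \<Rightarrow> nat \<Rightarrow> real"
  assumes "\<And>k l. f k l = f l k"
  shows "(\<Sum>k=1..K. \<Sum>l=1..K. f k l) = (\<Sum>k=1..K. f k k) + 2 * (\<Sum>(k,l)\<in>pairs K. f k l)"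
proof -
  define D where "D = (\<lambda>k. (k, k)) ` {1..K}"
  define L where "L = prod.swap ` pairs K"
  have "(\<Sum>k=1..K. \<Sum>l=1..K. f k l) = (\<Sum>(k,l)\<in>{1..K} \<times> {1..K}. f k l)"
    by (simp add: sum.cartesian_product)
  also have "{1..K} \<times> {1..K} = D \<union> (pairs K \<union> L)"
    by (auto simp: D_def L_def pairs_def image_iff)
  also have "(\<Sum>(k,l)\<in>D \<union> (pairs K \<union> L). f k l)
      = (\<Sum>(k,l)\<in>D. f k l) + ((\<Sum>(k,l)\<in>pairs K. f k l) + (\<Sum>(k,l)\<in>L. f k l))"
  proof -
    have "D \<inter> (pairs K \<union> L) = {}" "pairs K \<inter> L = {}"
      by (auto simp: D_def L_def pairs_def)
    moreover have "finite D" "finite L" by (simp_all add: D_def L_def)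
    ultimately show ?thesis by (simp add: sum.union_disjoint)
  qed
  also have "(\<Sum>(k,l)\<in>D. f k l) = (\<Sum>k=1..K. f k k)"
    unfolding D_def by (subst sum.reindex) (auto simp: inj_on_def)
  also have "(\<Sum>(k,l)\<in>L. f k l) = (\<Sum>(k,l)\<in>pairs K. f k l)"
    unfolding L_def by (subst sum.reindex) (auto simp: case_prod_unfold assms)
  finally show ?thesis by simp
qed

lemma card_pairs: "real (card (pairs K)) = (real K ^ 2 - real K) / 2"
  using sum_square_split[of "\<lambda>_ _. 1" K] by (simp add: power2_eq_square case_prod_unfold)

text \<open>Cauchy-Schwarz: the squares of the sizes of the \<open>m\<close> residue classes of \<open>K\<close> integers sum to
  at least \<open>K\<^sup>2/m\<close>. That sum counts ordered pairs, including the \<open>K\<close> pairs on the diagonal.\<close>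
lemma congruent_pairs_lower_bound:
  assumes "m > 0"
  shows "real K ^ 2 / real m \<le> 2 * congruent_count m K y + real K"
proof -
  define c where "c k = \<lfloor>y ^ k\<rfloor> mod int m" for k
  define N where "N r = (\<Sum>k=1..K. of_bool (c k = r) :: real)" for r
  define R where "R = {0..<int m}"
  have cR: "c k \<in> R" for k using assms by (simp add: c_def R_def)
  have one: "(\<Sum>r\<in>R. of_bool (c k = r) * x) = x" for k and x :: real
    using cR[of k] by (simp add: R_def of_bool_def if_distrib[of "\<lambda>t. t * x"] sum.delta cong: if_cong)
  have "(\<Sum>r\<in>R. N r) = real K"
    unfolding N_def using one[of _ 1] by (subst sum.swap) simp
  then have "real K ^ 2 \<le> real m * (\<Sum>r\<in>R. N r ^ 2)"
    using sum_squared_le_sum_of_squares[of N R] by (simp add: R_def mult.commute)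
  also have "(\<Sum>r\<in>R. N r ^ 2) = (\<Sum>r\<in>R. \<Sum>k=1..K. \<Sum>l=1..K. of_bool (c k = r) * of_bool (c l = r))"
    by (simp only: N_def power2_eq_square sum_product)
  also have "\<dots> = (\<Sum>k=1..K. \<Sum>l=1..K. \<Sum>r\<in>R. of_bool (c k = r) * of_bool (c l = r))"
    by (subst sum.swap, intro sum.cong refl, rule sum.swap)
  also have "\<dots> = (\<Sum>k=1..K. \<Sum>l=1..K. \<Sum>r\<in>R. of_bool (c k = r) * of_bool (c l = c k))"
    by (intro sum.cong refl) auto
  also have "\<dots> = (\<Sum>k=1..K. \<Sum>l=1..K. of_bool (c l = c k))"
    by (simp only: one)
  also have "\<dots> = (\<Sum>k=1..K. of_bool (c k = c k)) + 2 * (\<Sum>(k,l)\<in>pairs K. of_bool (c l = c k))"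
    by (rule sum_square_split, rule arg_cong[where f = of_bool], rule eq_commute)
  also have "(\<Sum>k=1..K. of_bool (c k = c k)) = real K" by simp
  also have "(\<Sum>(k,l)\<in>pairs K. of_bool (c l = c k)) = congruent_count m K y"
    unfolding congruent_count_def congruent_set_def c_def
    by (intro sum.cong) (auto simp: indicator_def mod_eq_dvd_iff)
  finally show ?thesis using assms by (simp add: field_simps)
qed

lemma distinct_count_le: "distinct_count m K y \<le> congruent_count m K y"
  unfolding distinct_count_def congruent_count_def by (intro sum_mono) (auto simp: indicator_def)

lemma distinct_count_nonneg: "distinct_count m K y \<ge> 0"
  unfolding distinct_count_def by (intro sum_nonneg) auto

text \<open>For fixed \<open>y > 1\<close> consecutive powers of \<open>y\<close> eventually differ by more than one, so that
  only finitely many pairs are lost when equal floors are excluded.\<close>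
lemma finite_coinciding_pairs:
  fixes y :: real
  assumes "y > 1"
  shows "finite {(k, l). k < l \<and> \<lfloor>y ^ k\<rfloor> = \<lfloor>y ^ l\<rfloor>}"
proof -
  obtain L where L: "1 / (y - 1) < y ^ L" using real_arch_pow[OF assms] by blast
  have "{(k, l). k < l \<and> \<lfloor>y ^ k\<rfloor> = \<lfloor>y ^ l\<rfloor>} \<subseteq> {..L} \<times> {..L}"
  proof clarify
    fix k l :: nat assume kl: "k < l" "\<lfloor>y ^ k\<rfloor> = \<lfloor>y ^ l\<rfloor>"
    then obtain n where n: "l = Suc n" "k \<le> n" by (cases l) auto
    have "y ^ n * (y - 1) = y ^ l - y ^ n" by (simp add: n algebra_simps)
    also have "\<dots> \<le> y ^ l - y ^ k" using n assms by simp
    also have "\<dots> < 1" using kl(2) by linarith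
    finally have "y ^ n < 1 / (y - 1)" using assms by (simp add: field_simps)
    then have "y ^ n < y ^ L" using L by simp
    then have "n < L" using assms by simp
    then show "k \<in> {..L} \<and> l \<in> {..L}" using n by simp
  qed
  then show ?thesis by (rule finite_subset) simp
qed

lemma congruent_count_le:
  assumes "y > 1"
  shows "\<exists>Z\<ge>0. \<forall>m K. congruent_count m K y \<le> distinct_count m K y + Z"
proof (intro exI[of _ "real (card {(k, l). k < l \<and> \<lfloor>y ^ k\<rfloor> = \<lfloor>y ^ l\<rfloor>})"] conjI allI)
  fix m K
  let ?Z = "{(k, l). k < l \<and> \<lfloor>y ^ k\<rfloor> = \<lfloor>y ^ l\<rfloor>}"
  have "congruent_count m K y \<le> (\<Sum>p\<in>pairs K. indicator (congruent_set m p \<inter> distinct_set p) y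
      + of_bool (p \<in> ?Z))"
    unfolding congruent_count_def by (intro sum_mono) (auto simp: indicator_def distinct_set_def pairs_def)
  also have "\<dots> = distinct_count m K y + real (card (pairs K \<inter> ?Z))"
    by (simp add: distinct_count_def sum.distrib sum.If_cases of_bool_def)
  also have "\<dots> \<le> distinct_count m K y + real (card ?Z)"
    using finite_coinciding_pairs[OF assms] by (simp add: card_mono)
  finally show "congruent_count m K y \<le> distinct_count m K y + real (card ?Z)" .
qed simp

text \<open>The sum under investigation, as a function of \<open>y\<close> and \<open>K\<close>.\<close>
definition W_sum :: "real \<Rightarrow> nat \<Rightarrow> real" where
  "W_sum y K = (\<Sum>(k, l)\<in>index_pairs y K. W (\<lfloor>y ^ l\<rfloor> - \<lfloor>y ^ k\<rfloor>))"

text \<open>The bound \<open>M\<close> only makes the sum over \<open>d\<close> finite: no difference of floors exceeds \<open>y ^ K\<close>.\<close>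
lemma W_sum_eq:
  assumes y: "y > 1" and M: "y ^ K \<le> real M"
  shows "W_sum y K = 3 / 2 * (\<Sum>d\<in>odd_squarefree \<inter> {1..M}. distinct_count (2 * d) K y / real d)"
proof -
  define n where "n = (\<lambda>(k, l). \<lfloor>y ^ l\<rfloor> - \<lfloor>y ^ k\<rfloor>)"
  have sub: "index_pairs y K \<subseteq> pairs K" by (auto simp: index_pairs_def pairs_def)
  have "W_sum y K = (\<Sum>p\<in>index_pairs y K. W (n p))"
    by (simp add: W_sum_def n_def case_prod_unfold)
  also have "\<dots> = (\<Sum>p\<in>pairs K. 3 / 2 * (\<Sum>d\<in>odd_squarefree \<inter> {1..M}.
        indicator (congruent_set (2 * d) p \<inter> distinct_set p) y / real d))"
  proof (rule sum.mono_neutral_cong_left[OF finite_pairs sub])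
    show "\<forall>p\<in>pairs K - index_pairs y K. 3 / 2 * (\<Sum>d\<in>odd_squarefree \<inter> {1..M}.
        indicator (congruent_set (2 * d) p \<inter> distinct_set p) y / real d) = 0"
    proof
      fix p assume p: "p \<in> pairs K - index_pairs y K"
      have "indicator (congruent_set (2 * d) p \<inter> distinct_set p) y = (0::real)" for d
      proof -
        have "y \<notin> congruent_set (2 * d) p \<inter> distinct_set p"
        proof
          assume *: "y \<in> congruent_set (2 * d) p \<inter> distinct_set p"
          obtain k l where kl: "p = (k, l)" by (cases p)
          have "int (2 * d) dvd \<lfloor>y ^ l\<rfloor> - \<lfloor>y ^ k\<rfloor>" "\<lfloor>y ^ k\<rfloor> \<noteq> \<lfloor>y ^ l\<rfloor>"
            using * by (auto simp: kl congruent_set_def distinct_set_def)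
          then have "2 dvd \<lfloor>y ^ l\<rfloor> - \<lfloor>y ^ k\<rfloor>"
            using dvd_trans[of 2 "int (2 * d)" "\<lfloor>y ^ l\<rfloor> - \<lfloor>y ^ k\<rfloor>"] by simp
          then have "[\<lfloor>y ^ k\<rfloor> = \<lfloor>y ^ l\<rfloor>] (mod 2)"
            by (simp add: cong_iff_dvd_diff dvd_diff_commute)
          then have "p \<in> index_pairs y K"
            using p \<open>\<lfloor>y ^ k\<rfloor> \<noteq> \<lfloor>y ^ l\<rfloor>\<close> by (simp add: kl pairs_def index_pairs_def)
          then show False using p by simp
        qed
        then show ?thesis by simp
      qed
      then show "3 / 2 * (\<Sum>d\<in>odd_squarefree \<inter> {1..M}.
        indicator (congruent_set (2 * d) p \<inter> distinct_set p) y / real d) = 0" by simp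
    qed
  next
    fix p assume p: "p \<in> index_pairs y K"
    obtain k l where kl: "p = (k, l)" by (cases p)
    have kl': "1 \<le> k" "k < l" "l \<le> K" and ne: "\<lfloor>y ^ k\<rfloor> \<noteq> \<lfloor>y ^ l\<rfloor>"
      and cong: "[\<lfloor>y ^ k\<rfloor> = \<lfloor>y ^ l\<rfloor>] (mod 2)"
      using p by (auto simp: kl index_pairs_def)
    have n: "n p = \<lfloor>y ^ l\<rfloor> - \<lfloor>y ^ k\<rfloor>" by (simp add: n_def kl)
    have even: "2 dvd n p" using cong by (simp add: n cong_iff_dvd_diff dvd_diff_commute)
    have "y ^ k \<le> y ^ l" using kl' y by (intro power_increasing) auto
    then have "\<lfloor>y ^ k\<rfloor> \<le> \<lfloor>y ^ l\<rfloor>" by (rule floor_mono)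
    then have pos: "n p > 0" using ne by (simp add: n)
    have "y ^ l \<le> y ^ K" using kl' y by (intro power_increasing) auto
    then have "\<lfloor>y ^ l\<rfloor> \<le> int M" using M by linarith
    moreover have "0 \<le> \<lfloor>y ^ k\<rfloor>" using y by simp
    ultimately have le: "n p \<le> int M" unfolding n by linarith
    have "W (n p) = 3 / 2 * (\<Sum>d | d \<in> odd_squarefree \<and> int d dvd n p. 1 / real d)"
      by (rule W_even) (use pos even in auto)
    also have "(\<Sum>d | d \<in> odd_squarefree \<and> int d dvd n p. 1 / real d) =
        (\<Sum>d\<in>odd_squarefree \<inter> {1..M}. indicator (congruent_set (2 * d) p \<inter> distinct_set p) y / real d)"
    proof (rule sum.mono_neutral_cong_left)
      show "{d. d \<in> odd_squarefree \<and> int d dvd n p} \<subseteq> odd_squarefree \<inter> {1..M}"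
      proof
        fix d assume d: "d \<in> {d. d \<in> odd_squarefree \<and> int d dvd n p}"
        then have "int d \<le> n p" using pos by (intro zdvd_imp_le) auto
        moreover have "d > 0" using d by (auto simp: odd_squarefree_def intro: Nat.gr0I)
        ultimately show "d \<in> odd_squarefree \<inter> {1..M}" using le d by auto
      qed
      have iff: "y \<in> congruent_set (2 * d) p \<inter> distinct_set p \<longleftrightarrow> int d dvd n p"
        if "d \<in> odd_squarefree" for d
      proof -
        have "coprime 2 (int d)" using that by (simp add: odd_squarefree_def)
        then have "int (2 * d) dvd n p \<longleftrightarrow> int d dvd n p"
          using even by (auto simp: divides_mult dest: dvd_mult_right)
        then show ?thesis using ne by (simp add: congruent_set_def distinct_set_def kl n[unfolded kl])
      qed
      then show "\<forall>d\<in>odd_squarefree \<inter> {1..M} - {d \<in> odd_squarefree. int d dvd n p}.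
         indicator (congruent_set (2 * d) p \<inter> distinct_set p) y / real d = 0" by auto
      fix d assume "d \<in> {d. d \<in> odd_squarefree \<and> int d dvd n p}"
      then show "1 / real d = indicator (congruent_set (2 * d) p \<inter> distinct_set p) y / real d"
        using iff by simp
    qed simp
    finally show "W (n p) = 3 / 2 * (\<Sum>d\<in>odd_squarefree \<inter> {1..M}.
        indicator (congruent_set (2 * d) p \<inter> distinct_set p) y / real d)" .
  qed
  also have "\<dots> = 3 / 2 * (\<Sum>d\<in>odd_squarefree \<inter> {1..M}. distinct_count (2 * d) K y / real d)"
    unfolding sum_distrib_left[symmetric] distinct_count_def sum_divide_distrib by (subst sum.swap) simp
  finally show ?thesis .
qed

lemma W_sum_mono:
  assumes "K \<le> K'"
  shows "W_sum y K \<le> W_sum y K'"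
proof -
  have "finite (index_pairs y K')"
    by (rule finite_subset[of _ "{..K'} \<times> {..K'}"]) (auto simp: index_pairs_def)
  then show ?thesis unfolding W_sum_def
    by (rule sum_mono2) (use assms in \<open>auto simp: index_pairs_def W_def prime_ge_0_int intro!: prod_nonneg add_nonneg_nonneg\<close>)
qed

text \<open>Fourth powers are dense enough, as the ratio of consecutive ones tends to \<open>1\<close>.\<close>
lemma tendsto_of_fourth_powers:
  fixes f :: "nat \<Rightarrow> real"
  assumes mono: "\<And>i j. i \<le> j \<Longrightarrow> f i \<le> f j" and nonneg: "\<And>i. f i \<ge> 0"
    and lim: "(\<lambda>j. f (j ^ 4) / real (j ^ 4) ^ 2) \<longlonglongrightarrow> c"
  shows "(\<lambda>K. f K / real K ^ 2) \<longlonglongrightarrow> c"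
proof -
  define r where "r K = nat \<lfloor>root 4 (real K)\<rfloor>" for K :: nat
  have r_le: "r K ^ 4 \<le> K" for K
  proof -
    have "real (r K) \<le> root 4 (real K)" by (simp add: r_def)
    then have "real (r K) ^ 4 \<le> root 4 (real K) ^ 4" by (intro power_mono) auto
    then have "real (r K ^ 4) \<le> real K" by simp
    then show ?thesis by (simp only: of_nat_le_iff)
  qed
  have r_ge: "K \<le> Suc (r K) ^ 4" for K
  proof -
    have "root 4 (real K) \<le> real (Suc (r K))" by (simp add: r_def) linarith
    then have "root 4 (real K) ^ 4 \<le> real (Suc (r K)) ^ 4" by (intro power_mono) auto
    then have "real K \<le> real (Suc (r K) ^ 4)" by simp
    then show ?thesis by (simp only: of_nat_le_iff)
  qed
  have r_lim: "filterlim r at_top at_top"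
    unfolding r_def by real_asymp
  have lim': "(\<lambda>j. f (Suc j ^ 4) / real (Suc j ^ 4) ^ 2) \<longlonglongrightarrow> c"
    using lim by (rule LIMSEQ_Suc)
  have ratio: "(\<lambda>j::nat. (real (Suc j ^ 4) / real (j ^ 4)) ^ 2) \<longlonglongrightarrow> 1" by real_asymp
  have up: "(\<lambda>j. (f (Suc j ^ 4) / real (Suc j ^ 4) ^ 2) * (real (Suc j ^ 4) / real (j ^ 4)) ^ 2)
      \<longlonglongrightarrow> c * 1"
    by (intro tendsto_mult lim' ratio)
  have ratio': "(\<lambda>j::nat. (real (j ^ 4) / real (Suc j ^ 4)) ^ 2) \<longlonglongrightarrow> 1" by real_asymp
  have low: "(\<lambda>j. (f (j ^ 4) / real (j ^ 4) ^ 2) * (real (j ^ 4) / real (Suc j ^ 4)) ^ 2) \<longlonglongrightarrow> c * 1"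
    by (intro tendsto_mult lim ratio')
  have ev: "eventually (\<lambda>K. r K \<ge> 1) sequentially"
    using r_lim by (simp add: filterlim_at_top)
  show ?thesis
  proof (rule tendsto_sandwich)
    show "(\<lambda>K. (f (r K ^ 4) / real (r K ^ 4) ^ 2)
        * (real (r K ^ 4) / real (Suc (r K) ^ 4)) ^ 2) \<longlonglongrightarrow> c"
      using filterlim_compose[OF low r_lim] by simp
    show "(\<lambda>K. (f (Suc (r K) ^ 4) / real (Suc (r K) ^ 4) ^ 2)
        * (real (Suc (r K) ^ 4) / real (r K ^ 4)) ^ 2) \<longlonglongrightarrow> c"
      using filterlim_compose[OF up r_lim] by simp
    show "\<forall>\<^sub>F K in sequentially. (f (r K ^ 4) / real (r K ^ 4) ^ 2)
        * (real (r K ^ 4) / real (Suc (r K) ^ 4)) ^ 2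
        \<le> f K / real K ^ 2"
      using ev
    proof eventually_elim
      case (elim K)
      have K: "K > 0" using r_le[of K] elim by (cases K) auto
      have "(f (r K ^ 4) / real (r K ^ 4) ^ 2) * (real (r K ^ 4) / real (Suc (r K) ^ 4)) ^ 2
          = f (r K ^ 4) / real (Suc (r K) ^ 4) ^ 2"
        using elim by (simp add: power_divide del: of_nat_power of_nat_Suc)
      also have "\<dots> \<le> f K / real K ^ 2"
        using K nonneg r_le[of K] r_ge[of K] by (intro frac_le mono power_mono) (auto simp del: of_nat_power)
      finally show ?case .
    qed
    show "\<forall>\<^sub>F K in sequentially. f K / real K ^ 2 \<le>
        (f (Suc (r K) ^ 4) / real (Suc (r K) ^ 4) ^ 2) * (real (Suc (r K) ^ 4) / real (r K ^ 4)) ^ 2"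
      using ev
    proof eventually_elim
      case (elim K)
      have "f K / real K ^ 2 \<le> f (Suc (r K) ^ 4) / real (r K ^ 4) ^ 2"
        using elim nonneg r_le[of K] r_ge[of K] by (intro frac_le mono power_mono) (auto simp del: of_nat_power)
      also have "\<dots> = (f (Suc (r K) ^ 4) / real (Suc (r K) ^ 4) ^ 2)
          * (real (Suc (r K) ^ 4) / real (r K ^ 4)) ^ 2"
        using elim by (simp add: power_divide del: of_nat_power of_nat_Suc)
      finally show ?case .
    qed
  qed
qed

section \<open>Mean values and the almost everywhere limit\<close>

text \<open>An upper bound for the amount by which the sum over \<open>d \<le> M\<close> in \<open>W_sum_eq\<close> exceeds the main
  part, namely the sum over \<open>d \<le> D\<close> of the lower bounds from \<open>congruent_pairs_lower_bound\<close> with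
  \<open>m = 2 d\<close>, divided by \<open>d\<close>. For \<open>d \<le> D\<close>, pairs with equal floors are counted as well, since
  the lower bound is about all congruent pairs.\<close>
definition excess :: "nat \<Rightarrow> nat \<Rightarrow> nat \<Rightarrow> real \<Rightarrow> real" where
  "excess D M K y =
     (\<Sum>d\<in>odd_squarefree \<inter> {1..D}. (congruent_count (2 * d) K y
         - (real K ^ 2 / (4 * real d) - real K / 2)) / real d)
     + (\<Sum>d\<in>odd_squarefree \<inter> {D<..M}. distinct_count (2 * d) K y / real d)"

lemma excess_nonneg: "excess D M K y \<ge> 0"
  unfolding excess_def
proof (intro add_nonneg_nonneg sum_nonneg divide_nonneg_nonneg distinct_count_nonneg)
  fix d assume "d \<in> odd_squarefree \<inter> {1..D}"
  then have "d > 0" by auto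
  then show "0 \<le> congruent_count (2 * d) K y - (real K ^ 2 / (4 * real d) - real K / 2)"
    using congruent_pairs_lower_bound[of "2 * d" K y] by (simp add: field_simps)
qed auto

lemma congruent_set_measurable [measurable]: "congruent_set m p \<in> sets borel"
  unfolding congruent_set_def by (cases p) simp

lemma distinct_set_measurable [measurable]: "distinct_set p \<in> sets borel"
  unfolding distinct_set_def by (cases p) simp

lemma has_integral_indicator_restrict:
  fixes a b :: real
  assumes "A \<in> sets borel"
  shows "has_bochner_integral (restrict_space lborel {a..<b}) (indicator A) (measure lborel ({a..<b} \<inter> A))"
proof -
  have "{a..<b} \<inter> A \<in> fmeasurable lborel"
    by (rule fmeasurable_bounded[OF bounded_subset[of "{a..<b}"]]) (use assms in auto)
  then have "has_bochner_integral lborel (indicator ({a..<b} \<inter> A)) (measure lborel ({a..<b} \<inter> A))"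
    by (intro has_bochner_integral_real_indicator) (auto simp: fmeasurable_def)
  moreover have "(\<lambda>x. indicator {a..<b} x *\<^sub>R indicator A x)
      = (indicator ({a..<b} \<inter> A) :: real \<Rightarrow> real)"
    by (simp add: fun_eq_iff indicator_inter_arith)
  ultimately show ?thesis
    by (subst has_bochner_integral_restrict_space) simp_all
qed

lemma sum_geometric_pairs_le:
  fixes a :: real
  assumes "a > 1"
  shows "(\<Sum>(k, l)\<in>pairs K. 1 / a ^ (l - 1 - k)) \<le> real K * (a / (a - 1))"
proof -
  have "(\<Sum>l\<in>{k<..K}. 1 / a ^ (l - 1 - k)) \<le> a / (a - 1)" for k
  proof -
    have "(\<Sum>l\<in>{k<..K}. 1 / a ^ (l - 1 - k)) = (\<Sum>i<K - k. (1 / a) ^ i)"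
      by (rule sum.reindex_bij_witness[of _ "\<lambda>i. i + k + 1" "\<lambda>l. l - 1 - k"]) (auto simp: power_one_over)
    also have "\<dots> \<le> (\<Sum>i. (1 / a) ^ i)"
      using assms by (intro sum_le_suminf summable_geometric) auto
    also have "\<dots> = a / (a - 1)"
      using assms by (subst suminf_geometric) (auto simp: field_simps)
    finally show ?thesis .
  qed
  then have "(\<Sum>k=1..K. \<Sum>l\<in>{k<..K}. 1 / a ^ (l - 1 - k)) \<le> (\<Sum>k=1..K. a / (a - 1))"
    by (intro sum_mono)
  then show ?thesis by (simp add: sum_pairs_eq)
qed

lemma sum_inverse_squares_tail_le:
  assumes "D > 0"
  shows "(\<Sum>d\<in>{D<..M}. 1 / real d ^ 2) \<le> 1 / real D"
proof -
  have "(\<Sum>d\<in>{D<..M}. 1 / real d ^ 2) \<le> 1 / real D - 1 / real M" if "M \<ge> D"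
    using that
  proof (induction M rule: dec_induct)
    case (step n)
    have "{D<..Suc n} = insert (Suc n) {D<..n}" using step by auto
    then have "(\<Sum>d\<in>{D<..Suc n}. 1 / real d ^ 2)
        = 1 / real (Suc n) ^ 2 + (\<Sum>d\<in>{D<..n}. 1 / real d ^ 2)"
      by simp
    also have "1 / real (Suc n) ^ 2 \<le> 1 / (real n * real (Suc n))"
      using step assms by (intro divide_left_mono) (auto simp: power2_eq_square)
    also have "\<dots> = 1 / real n - 1 / real (Suc n)"
      using step assms by (simp add: field_simps)
    finally show ?case using step.IH by simp
  qed simp
  then show ?thesis by (cases "M \<ge> D") (auto intro: order_trans)
qed

context
  fixes a b :: real
  assumes ab: "1 < a" "a < b"
begin

text \<open>Lebesgue measure on \<open>[a, b)\<close>.\<close>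
abbreviation window :: "real measure" where "window \<equiv> restrict_space lborel {a..<b}"

lemma integral_congruent_count:
  assumes "m > 0"
  shows "integrable window (congruent_count m K)"
    and "integral\<^sup>L window (congruent_count m K)
        \<le> (b - a) / real m * card (pairs K) + (1 + ln b) * (a / (a - 1)) * real K"
proof -
  have int: "has_bochner_integral window (congruent_count m K) (\<Sum>p\<in>pairs K. measure lborel ({a..<b} \<inter> congruent_set m p))"
    unfolding congruent_count_def by (intro has_bochner_integral_sum has_integral_indicator_restrict) measurable
  then show "integrable window (congruent_count m K)" by (rule integrable.intros)
  have "integral\<^sup>L window (congruent_count m K)
      = (\<Sum>p\<in>pairs K. measure lborel ({a..<b} \<inter> congruent_set m p))"
    using int by (rule has_bochner_integral_integral_eq)
  also have "\<dots> \<le> (\<Sum>(k, l)\<in>pairs K. (b - a) / real m + (1 + ln b) * (1 / a ^ (l - 1 - k)))"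
  proof (rule sum_mono, clarify)
    fix k l assume "(k, l) \<in> pairs K"
    then show "measure lborel ({a..<b} \<inter> congruent_set m (k, l))
        \<le> (b - a) / real m + (1 + ln b) * (1 / a ^ (l - 1 - k))"
      using measure_congruent_powers_le[OF ab, of k l m] assms
      by (simp add: pairs_def congruent_set_def Int_def)
  qed
  also have "\<dots> = (b - a) / real m * card (pairs K)
      + (1 + ln b) * (\<Sum>(k, l)\<in>pairs K. 1 / a ^ (l - 1 - k))"
    by (simp add: case_prod_unfold sum.distrib sum_distrib_left)
  also have "\<dots> \<le> (b - a) / real m * card (pairs K) + (1 + ln b) * (real K * (a / (a - 1)))"
    using ab by (intro add_left_mono mult_left_mono sum_geometric_pairs_le) auto
  finally show "integral\<^sup>L window (congruent_count m K)
      \<le> (b - a) / real m * card (pairs K) + (1 + ln b) * (a / (a - 1)) * real K"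
    by (simp add: mult_ac)
qed

lemma integral_distinct_count:
  assumes "m > 0"
  shows "integrable window (distinct_count m K)"
    and "integral\<^sup>L window (distinct_count m K) \<le> 2 * (b - 1) / real m * card (pairs K)"
proof -
  have int: "has_bochner_integral window (distinct_count m K) (\<Sum>p\<in>pairs K. measure lborel ({a..<b} \<inter> (congruent_set m p \<inter> distinct_set p)))"
    unfolding distinct_count_def by (intro has_bochner_integral_sum has_integral_indicator_restrict) measurable
  then show "integrable window (distinct_count m K)" by (rule integrable.intros)
  have "integral\<^sup>L window (distinct_count m K)
      = (\<Sum>p\<in>pairs K. measure lborel ({a..<b} \<inter> (congruent_set m p \<inter> distinct_set p)))"
    using int by (rule has_bochner_integral_integral_eq)
  also have "\<dots> \<le> (\<Sum>p\<in>pairs K. 2 * (b - 1) / real m)"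
  proof (rule sum_mono)
    fix p assume p: "p \<in> pairs K"
    obtain k l where kl: "p = (k, l)" by (cases p)
    have "measure lborel ({a..<b} \<inter> (congruent_set m p \<inter> distinct_set p))
        \<le> measure lborel ({1..<b} \<inter> (congruent_set m p \<inter> distinct_set p))"
      by (rule measure_mono_fmeasurable[OF _ _ fmeasurable_bounded[OF bounded_subset[of "{1..<b}"]]])
         (use ab in auto)
    also have "{1..<b} \<inter> (congruent_set m p \<inter> distinct_set p) =
        {y \<in> {1..<b}. \<lfloor>y ^ k\<rfloor> \<noteq> \<lfloor>y ^ l\<rfloor> \<and> int m dvd \<lfloor>y ^ l\<rfloor> - \<lfloor>y ^ k\<rfloor>}"
      by (auto simp: kl congruent_set_def distinct_set_def)
    also have "measure lborel \<dots> \<le> 2 * (b - 1) / real m"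
      using p ab assms by (intro measure_nonzero_multiple_le) (auto simp: kl pairs_def)
    finally show "measure lborel ({a..<b} \<inter> (congruent_set m p \<inter> distinct_set p))
        \<le> 2 * (b - 1) / real m" .
  qed
  finally show "integral\<^sup>L window (distinct_count m K) \<le> 2 * (b - 1) / real m * card (pairs K)"
    by (simp add: mult_ac)
qed

lemma integral_window_const: "integral\<^sup>L window (\<lambda>_. c :: real)
    = c * (b - a)" "integrable window (\<lambda>_. c :: real)"
proof -
  have "has_bochner_integral window (indicator UNIV :: real \<Rightarrow> real) (b - a)"
    using has_integral_indicator_restrict[of UNIV a b] ab by simp
  then have "has_bochner_integral window (\<lambda>x. c * indicator UNIV x) (c * (b - a))"
    by (rule has_bochner_integral_mult_right)
  then have *: "has_bochner_integral window (\<lambda>x. c) (c * (b - a))" by simp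
  from * show "integral\<^sup>L window (\<lambda>_. c :: real) = c * (b - a)"
    by (rule has_bochner_integral_integral_eq)
  from * show "integrable window (\<lambda>_. c :: real)" by (rule integrable.intros)
qed

text \<open>The main terms \<open>(b - a) K\<^sup>2 / (4 d)\<close> cancel for every \<open>d \<le> D\<close>, which leaves \<open>O(K)\<close> for each
  of these \<open>d\<close>; the others contribute \<open>O(K\<^sup>2/d\<^sup>2)\<close>.\<close>
lemma integral_excess:
  assumes "D > 0"
  shows "integrable window (excess D M K)"
    and "integral\<^sup>L window (excess D M K) \<le>
      ((b - a) / 2 + (1 + ln b) * (a / (a - 1))) * (real D * real K) + (b - 1) * (real K ^ 2 / real D)"
proof -
  define C where "C = (b - a) / 2 + (1 + ln b) * (a / (a - 1))"
  have C: "C \<ge> 0" unfolding C_def using ab by (intro add_nonneg_nonneg mult_nonneg_nonneg) auto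
  define Q1 where "Q1 = odd_squarefree \<inter> {1..D}"
  define Q2 where "Q2 = odd_squarefree \<inter> {D<..M}"
  have fin: "finite Q1" "finite Q2" by (auto simp: Q1_def Q2_def)
  have pos: "d > 0" if "d \<in> Q1 \<union> Q2" for d using that by (auto simp: Q1_def Q2_def)
  define g where "g d y = (congruent_count (2 * d) K y - (real K ^ 2 / (4 * real d) - real K / 2))
      / real d" for d y
  define h where "h d y = distinct_count (2 * d) K y / real d" for d y
  have eq: "excess D M K = (\<lambda>y. (\<Sum>d\<in>Q1. g d y) + (\<Sum>d\<in>Q2. h d y))"
    by (simp add: excess_def fun_eq_iff Q1_def Q2_def g_def h_def)
  have g_int: "integrable window (g d)" if "d \<in> Q1" for d
    unfolding g_def using integral_congruent_count(1)[of "2 * d" K] integral_window_const(2) pos[of d] that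
    by (intro integrable_divide Bochner_Integration.integrable_diff) auto
  have h_int: "integrable window (h d)" if "d \<in> Q2" for d
    unfolding h_def using integral_distinct_count(1)[of "2 * d" K] pos[of d] that
    by (intro integrable_divide) auto
  show "integrable window (excess D M K)"
    unfolding eq using g_int h_int by (intro Bochner_Integration.integrable_add Bochner_Integration.integrable_sum) auto
  have g_le: "integral\<^sup>L window (g d) \<le> C * real K" if d: "d \<in> Q1" for d
  proof -
    have d0: "real d \<ge> 1" using pos[of d] d by auto
    have "integral\<^sup>L window (g d) = (integral\<^sup>L window (congruent_count (2 * d) K)
        - (real K ^ 2 / (4 * real d) - real K / 2) * (b - a)) / real d"
    proof -
      have "integrable window (congruent_count (2 * d) K)"
        using d0 by (intro integral_congruent_count) simp
      from Bochner_Integration.integral_diff[OF this integral_window_const(2)]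
      show ?thesis unfolding g_def integral_divide_zero integral_window_const(1) by simp
    qed
    also have "\<dots> \<le> ((b - a) / real (2 * d) * card (pairs K) + (1 + ln b) * (a / (a - 1)) * real K
         - (real K ^ 2 / (4 * real d) - real K / 2) * (b - a)) / real d"
      using integral_congruent_count(2)[of "2 * d" K] d0 by (intro divide_right_mono diff_right_mono) auto
    also have "\<dots> = (C * real K - (b - a) * real K / (4 * real d)) / real d"
      unfolding card_pairs C_def using d0 by (simp add: field_simps)
    also have "\<dots> \<le> (C * real K) / real d"
      using d0 ab by (intro divide_right_mono) auto
    also have "\<dots> \<le> C * real K / 1"
      using d0 C by (intro divide_left_mono) auto
    finally show ?thesis by simp
  qed
  have h_le: "integral\<^sup>L window (h d) \<le> (b - 1) * real K ^ 2 * (1 / real d ^ 2)"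
    if d: "d \<in> Q2" for d
  proof -
    have d0: "real d \<ge> 1" using pos[of d] d by auto
    have "integral\<^sup>L window (h d) = integral\<^sup>L window (distinct_count (2 * d) K) / real d"
      unfolding h_def by simp
    also have "\<dots> \<le> (2 * (b - 1) / real (2 * d) * card (pairs K)) / real d"
      using integral_distinct_count(2)[of "2 * d" K] d0 by (intro divide_right_mono) auto
    also have "\<dots> = (b - 1) * card (pairs K) * (1 / real d ^ 2)"
      using d0 by (simp add: field_simps power2_eq_square)
    also have "\<dots> \<le> (b - 1) * real K ^ 2 * (1 / real d ^ 2)"
    proof -
      have "real (card (pairs K)) \<le> real K ^ 2"
      proof -
        have "- real K \<le> real K ^ 2" by (rule order_trans[of _ 0]) simp_all
        then show ?thesis by (simp add: card_pairs)
      qed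
      then show ?thesis using ab by (intro mult_right_mono mult_left_mono) auto
    qed
    finally show ?thesis .
  qed
  have "integral\<^sup>L window (excess D M K)
      = (\<Sum>d\<in>Q1. integral\<^sup>L window (g d)) + (\<Sum>d\<in>Q2. integral\<^sup>L window (h d))"
    unfolding eq using g_int h_int
    by (subst Bochner_Integration.integral_add)
       (auto intro!: Bochner_Integration.integrable_sum arg_cong2[where f = "(+)"] Bochner_Integration.integral_sum)
  also have "\<dots> \<le> (\<Sum>d\<in>Q1. C * real K) + (\<Sum>d\<in>Q2. (b - 1) * real K ^ 2 * (1 / real d ^ 2))"
    by (intro add_mono sum_mono g_le h_le)
  also have "(\<Sum>d\<in>Q1. C * real K) \<le> C * (real D * real K)"
  proof -
    have "card Q1 \<le> card {1..D}" unfolding Q1_def by (intro card_mono) auto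
    then have "real (card Q1) * (C * real K) \<le> real D * (C * real K)"
      using C by (intro mult_right_mono) auto
    then show ?thesis by (simp add: mult_ac)
  qed
  also have "(\<Sum>d\<in>Q2. (b - 1) * real K ^ 2 * (1 / real d ^ 2)) \<le> (b - 1) * real K ^ 2 * (1 / real D)"
  proof -
    have "(\<Sum>d\<in>Q2. 1 / real d ^ 2) \<le> (\<Sum>d\<in>{D<..M}. 1 / real d ^ 2)"
      unfolding Q2_def by (intro sum_mono2) auto
    also have "\<dots> \<le> 1 / real D" by (rule sum_inverse_squares_tail_le[OF assms])
    finally show ?thesis
      unfolding sum_distrib_left[symmetric] using ab by (intro mult_left_mono) auto
  qed
  finally show "integral\<^sup>L window (excess D M K) \<le>
      ((b - a) / 2 + (1 + ln b) * (a / (a - 1))) * (real D * real K) + (b - 1) * (real K ^ 2 / real D)"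
    unfolding C_def by simp
qed

end

text \<open>By monotone convergence the sum of all \<open>f j\<close> is integrable, hence finite almost everywhere.\<close>
lemma AE_tendsto_0_of_summable_integrals:
  fixes f :: "nat \<Rightarrow> 'a \<Rightarrow> real"
  assumes int: "\<And>j. integrable M (f j)" and nonneg: "\<And>j x. f j x \<ge> 0"
    and le: "\<And>j. integral\<^sup>L M (f j) \<le> c j" and c: "summable c"
  shows "AE x in M. (\<lambda>j. f j x) \<longlonglongrightarrow> 0"
proof -
  have [measurable]: "f j \<in> borel_measurable M" for j using int by (rule borel_measurable_integrable)
  have int_nonneg: "0 \<le> integral\<^sup>L M (f j)" for j by (rule Bochner_Integration.integral_nonneg) (rule nonneg)
  have "(\<integral>\<^sup>+x. (\<Sum>j. ennreal (f j x)) \<partial>M) = (\<Sum>j. \<integral>\<^sup>+x. ennreal (f j x) \<partial>M)"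
    by (rule nn_integral_suminf) measurable
  also have "\<dots> = (\<Sum>j. ennreal (integral\<^sup>L M (f j)))"
    using int nonneg by (simp add: nn_integral_eq_integral)
  also have "\<dots> = ennreal (\<Sum>j. integral\<^sup>L M (f j))"
    by (rule suminf_ennreal2[OF int_nonneg summable_comparison_test'[OF c]])
       (use int_nonneg le in auto)
  finally have "(\<integral>\<^sup>+x. (\<Sum>j. ennreal (f j x)) \<partial>M) \<noteq> \<infinity>" by simp
  then have "AE x in M. (\<Sum>j. ennreal (f j x)) \<noteq> \<infinity>"
    by (intro nn_integral_PInf_AE) measurable
  then show ?thesis
  proof eventually_elim
    case (elim x)
    then have "summable (\<lambda>j. f j x)"
      by (intro summable_suminf_not_top nonneg) simp
    then show ?case by (rule summable_LIMSEQ_zero)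
  qed
qed

lemma W_sum_bounds:
  assumes y: "y > 1" and Z: "\<And>m. congruent_count m K y \<le> distinct_count m K y + Z"
    and M: "y ^ K \<le> real M" "D \<le> M"
  shows "3 / 2 * (real K ^ 2 / 4 * (\<Sum>d\<in>odd_squarefree \<inter> {1..D}. 1 / real d ^ 2)
      - real D * (real K / 2 + Z)) \<le> W_sum y K"
    and "W_sum y K \<le> 3 / 2 * (real K ^ 2 / 4 * (\<Sum>d\<in>odd_squarefree \<inter> {1..D}. 1 / real d ^ 2)
        + excess D M K y)"
proof -
  define Q1 where "Q1 = odd_squarefree \<inter> {1..D}"
  define Q2 where "Q2 = odd_squarefree \<inter> {D<..M}"
  have "Z \<ge> 0" using Z[of 0] distinct_count_le[of 0 K y] by simp
  have pos: "real d \<ge> 1" if "d \<in> Q1" for d using that by (auto simp: Q1_def)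
  have "odd_squarefree \<inter> {1..M} = Q1 \<union> Q2" using M(2) by (auto simp: Q1_def Q2_def)
  then have eq: "W_sum y K = 3 / 2 * ((\<Sum>d\<in>Q1. distinct_count (2 * d) K y / real d)
      + (\<Sum>d\<in>Q2. distinct_count (2 * d) K y / real d))"
    unfolding W_sum_eq[OF y M(1)] by (subst sum.union_disjoint[symmetric]) (auto simp: Q1_def Q2_def)
  have main: "(\<Sum>d\<in>Q1. real K ^ 2 / (4 * real d) / real d)
      = real K ^ 2 / 4 * (\<Sum>d\<in>Q1. 1 / real d ^ 2)"
    unfolding sum_distrib_left by (intro sum.cong) (auto simp: power2_eq_square)
  have "(\<Sum>d\<in>Q1. real K ^ 2 / (4 * real d) / real d) - real D * (real K / 2 + Z)
      \<le> (\<Sum>d\<in>Q1. real K ^ 2 / (4 * real d) / real d) - (\<Sum>d\<in>Q1. real K / 2 + Z)"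
  proof -
    have "card Q1 \<le> card {1..D}" unfolding Q1_def by (intro card_mono) auto
    then have "real (card Q1) * (real K / 2 + Z) \<le> real D * (real K / 2 + Z)"
      using \<open>Z \<ge> 0\<close> by (intro mult_right_mono) auto
    then show ?thesis by simp
  qed
  also have "\<dots> = (\<Sum>d\<in>Q1. real K ^ 2 / (4 * real d) / real d - (real K / 2 + Z))"
    by (rule sum_subtractf[symmetric])
  also have "\<dots> \<le> (\<Sum>d\<in>Q1. distinct_count (2 * d) K y / real d)"
  proof (rule sum_mono)
    fix d assume d: "d \<in> Q1"
    have "real K ^ 2 / (4 * real d) - (real K / 2 + Z) \<le> distinct_count (2 * d) K y"
    proof -
      have "real K ^ 2 / real (2 * d) \<le> 2 * congruent_count (2 * d) K y + real K"
        using pos[OF d] by (intro congruent_pairs_lower_bound) auto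
      moreover have "real K ^ 2 / (4 * real d) = real K ^ 2 / real (2 * d) / 2" by simp
      ultimately show ?thesis using Z[of "2 * d"] by linarith
    qed
    then have "(real K ^ 2 / (4 * real d) - (real K / 2 + Z)) / real d
        \<le> distinct_count (2 * d) K y / real d"
      by (rule divide_right_mono) simp
    moreover have "(real K / 2 + Z) / real d \<le> (real K / 2 + Z) / 1"
      using pos[OF d] \<open>Z \<ge> 0\<close> by (intro divide_left_mono) auto
    ultimately show "real K ^ 2 / (4 * real d) / real d - (real K / 2 + Z)
        \<le> distinct_count (2 * d) K y / real d"
      by (simp add: diff_divide_distrib)
  qed
  also have "\<dots> \<le> (\<Sum>d\<in>Q1. distinct_count (2 * d) K y / real d)
      + (\<Sum>d\<in>Q2. distinct_count (2 * d) K y / real d)"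
    using distinct_count_nonneg by (simp add: sum_nonneg)
  finally show "3 / 2 * (real K ^ 2 / 4 * (\<Sum>d\<in>odd_squarefree \<inter> {1..D}. 1 / real d ^ 2)
      - real D * (real K / 2 + Z)) \<le> W_sum y K"
    unfolding eq main Q1_def[symmetric] by simp
  have "(\<Sum>d\<in>Q1. distinct_count (2 * d) K y / real d)
      \<le> (\<Sum>d\<in>Q1. real K ^ 2 / (4 * real d) / real d + (congruent_count (2 * d) K y - (real K ^ 2 / (4 * real d) - real K / 2)) / real d)"
  proof (rule sum_mono)
    fix d assume d: "d \<in> Q1"
    have "distinct_count (2 * d) K y
        \<le> real K ^ 2 / (4 * real d) + (congruent_count (2 * d) K y - (real K ^ 2 / (4 * real d) - real K / 2))"
      using distinct_count_le[of "2 * d" K y] by simp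
    then have "distinct_count (2 * d) K y / real d
        \<le> (real K ^ 2 / (4 * real d) + (congruent_count (2 * d) K y - (real K ^ 2 / (4 * real d) - real K / 2))) / real d"
      by (rule divide_right_mono) simp
    then show "distinct_count (2 * d) K y / real d
        \<le> real K ^ 2 / (4 * real d) / real d + (congruent_count (2 * d) K y - (real K ^ 2 / (4 * real d) - real K / 2)) / real d"
      by (simp only: add_divide_distrib)
  qed
  then show "W_sum y K \<le> 3 / 2 * (real K ^ 2 / 4 * (\<Sum>d\<in>odd_squarefree \<inter> {1..D}. 1 / real d ^ 2)
      + excess D M K y)"
    unfolding eq excess_def Q1_def[symmetric] Q2_def[symmetric] main[symmetric] sum.distrib by simp
qed

lemma W_sum_tendsto_fourth_powers:
  assumes y: "y > 1" and M: "\<And>j. y ^ (j ^ 4) \<le> real (M j)" "\<And>j. j ^ 2 \<le> M j"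
    and lim: "(\<lambda>j. excess (j ^ 2) (M j) (j ^ 4) y / real (j ^ 4) ^ 2) \<longlonglongrightarrow> 0"
  shows "(\<lambda>j. W_sum y (j ^ 4) / real (j ^ 4) ^ 2) \<longlonglongrightarrow> 3 * zeta 2 / (10 * zeta 4)"
proof -
  obtain Z where Z: "\<And>m K. congruent_count m K y \<le> distinct_count m K y + Z"
    using congruent_count_le[OF y] by blast
  define q where "q = 4 / 5 * (zeta 2 / zeta 4)"
  define T where "T D = (\<Sum>d\<in>odd_squarefree \<inter> {1..D}. 1 / real d ^ 2)" for D :: nat
  have T: "T \<longlonglongrightarrow> q"
  proof -
    have "((\<lambda>d. if d \<in> odd_squarefree then 1 / real d ^ 2 else 0) has_sum q) UNIV"
      using has_sum_odd_squarefree unfolding q_def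
      by (subst has_sum_cong_neutral[where T = odd_squarefree and g = "\<lambda>d. 1 / real d ^ 2"]) auto
    then have "(\<lambda>d. if d \<in> odd_squarefree then 1 / real d ^ 2 else 0) sums q"
      by (rule has_sum_imp_sums)
    then have "(\<lambda>D. \<Sum>d\<le>D. if d \<in> odd_squarefree then 1 / real d ^ 2 else 0) \<longlonglongrightarrow> q"
      by (simp add: sums_def_le)
    moreover have "(\<Sum>d\<le>D. if d \<in> odd_squarefree then 1 / real d ^ 2 else 0) = T D" for D
      unfolding T_def by (intro sum.mono_neutral_cong_right) (auto simp: Suc_le_eq)
    ultimately show ?thesis by simp
  qed
  have T': "(\<lambda>j. T (j ^ 2)) \<longlonglongrightarrow> q"
    by (rule filterlim_compose[OF T]) real_asymp
  have c: "3 / 2 * (1 / 4 * q - 0) = 3 * zeta 2 / (10 * zeta 4)" "3 / 2 * (1 / 4 * q + 0)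
      = 3 * zeta 2 / (10 * zeta 4)"
    by (simp_all add: q_def)
  have ev: "eventually (\<lambda>j::nat. j > 0) sequentially" by (rule eventually_gt_at_top)
  show ?thesis
  proof (rule tendsto_sandwich)
    have "(\<lambda>j. real (j ^ 2) * (real (j ^ 4) / 2 + Z) / real (j ^ 4) ^ 2) \<longlonglongrightarrow> 0"
      by real_asymp
    then show "(\<lambda>j. 3 / 2 * (1 / 4 * T (j ^ 2)
        - real (j ^ 2) * (real (j ^ 4) / 2 + Z) / real (j ^ 4) ^ 2))
        \<longlonglongrightarrow> 3 * zeta 2 / (10 * zeta 4)"
      unfolding c(1)[symmetric] by (intro tendsto_intros T')
    show "(\<lambda>j. 3 / 2 * (1 / 4 * T (j ^ 2) + excess (j ^ 2) (M j) (j ^ 4) y / real (j ^ 4) ^ 2))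
        \<longlonglongrightarrow> 3 * zeta 2 / (10 * zeta 4)"
      unfolding c(2)[symmetric] by (intro tendsto_intros T' lim)
    show "\<forall>\<^sub>F j in sequentially. 3 / 2
        * (1 / 4 * T (j ^ 2) - real (j ^ 2) * (real (j ^ 4) / 2 + Z) / real (j ^ 4) ^ 2)
        \<le> W_sum y (j ^ 4) / real (j ^ 4) ^ 2"
      using ev
    proof eventually_elim
      case (elim j)
      have "3 / 2 * (real (j ^ 4) ^ 2 / 4 * T (j ^ 2) - real (j ^ 2) * (real (j ^ 4) / 2 + Z))
          \<le> W_sum y (j ^ 4)"
        unfolding T_def by (rule W_sum_bounds(1)[OF y Z M])
      then have "3 / 2 * (real (j ^ 4) ^ 2 / 4 * T (j ^ 2)
          - real (j ^ 2) * (real (j ^ 4) / 2 + Z)) / real (j ^ 4) ^ 2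
          \<le> W_sum y (j ^ 4) / real (j ^ 4) ^ 2"
        by (rule divide_right_mono) simp
      then show ?case using elim by (simp add: diff_divide_distrib del: of_nat_power)
    qed
    show "\<forall>\<^sub>F j in sequentially. W_sum y (j ^ 4) / real (j ^ 4) ^ 2
        \<le> 3 / 2 * (1 / 4 * T (j ^ 2) + excess (j ^ 2) (M j) (j ^ 4) y / real (j ^ 4) ^ 2)"
      using ev
    proof eventually_elim
      case (elim j)
      have "W_sum y (j ^ 4) \<le> 3 / 2
          * (real (j ^ 4) ^ 2 / 4 * T (j ^ 2) + excess (j ^ 2) (M j) (j ^ 4) y)"
        unfolding T_def by (rule W_sum_bounds(2)[OF y Z M])
      then have "W_sum y (j ^ 4) / real (j ^ 4) ^ 2
          \<le> 3 / 2 * (real (j ^ 4) ^ 2 / 4 * T (j ^ 2) + excess (j ^ 2) (M j) (j ^ 4) y) / real (j ^ 4) ^ 2"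
        by (rule divide_right_mono) simp
      then show ?case using elim by (simp add: add_divide_distrib del: of_nat_power)
    qed
  qed
qed

text \<open>The cut-off \<open>M\<close> must not depend on \<open>y\<close>, hence its definition in terms of the right end \<open>b\<close>.\<close>
lemma AE_W_sum_tendsto:
  fixes a b :: real
  assumes ab: "1 < a" "a < b"
  shows "AE y in lborel. y \<in> {a..<b} \<longrightarrow> (\<lambda>K. W_sum y K / real K ^ 2) \<longlonglongrightarrow> 3 * zeta 2 / (10 * zeta 4)"
proof -
  define M where "M j = nat \<lceil>b ^ (j ^ 4)\<rceil> + j ^ 2" for j :: nat
  define C where "C = ((b - a) / 2 + (1 + ln b) * (a / (a - 1))) + (b - 1)"
  define f where "f j y = excess (j ^ 2) (M j) (j ^ 4) y / real (j ^ 4) ^ 2" for j y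
  have "AE y in restrict_space lborel {a..<b}. (\<lambda>j. f (Suc j) y) \<longlonglongrightarrow> 0"
  proof (rule AE_tendsto_0_of_summable_integrals)
    show "integrable (restrict_space lborel {a..<b}) (f (Suc j))" for j
      unfolding f_def using integral_excess(1)[OF ab] by (intro integrable_divide) auto
    show "f (Suc j) y \<ge> 0" for j y
      unfolding f_def by (intro divide_nonneg_nonneg excess_nonneg) simp
    show "integral\<^sup>L (restrict_space lborel {a..<b}) (f (Suc j)) \<le> C * (1 / real (Suc j) ^ 2)" for j
    proof -
      define i where "i = Suc j"
      have i: "i > 0" by (simp add: i_def)
      have "integral\<^sup>L (restrict_space lborel {a..<b}) (f i)
          = integral\<^sup>L (restrict_space lborel {a..<b}) (excess (i ^ 2) (M i) (i ^ 4)) / real (i ^ 4) ^ 2"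
        unfolding f_def by simp
      also have "\<dots> \<le> (((b - a) / 2 + (1 + ln b) * (a / (a - 1))) * (real (i ^ 2) * real (i ^ 4))
          + (b - 1) * (real (i ^ 4) ^ 2 / real (i ^ 2))) / real (i ^ 4) ^ 2"
        using i by (intro divide_right_mono integral_excess(2)[OF ab]) auto
      also have "\<dots> = C * (1 / real i ^ 2)"
      proof -
        have "real (i ^ 2) * real (i ^ 4) / real (i ^ 4) ^ 2 = 1 / real i ^ 2"
          "real (i ^ 4) ^ 2 / real (i ^ 2) / real (i ^ 4) ^ 2 = 1 / real i ^ 2"
          using i by (simp_all add: field_simps flip: power_mult power_add)
        then show ?thesis
          unfolding C_def by (simp only: add_divide_distrib distrib_right flip: times_divide_eq_right)
      qed
      finally show ?thesis unfolding i_def .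
    qed
    show "summable (\<lambda>j. C * (1 / real (Suc j) ^ 2))"
      by (intro summable_mult) (use inverse_power_summable[of 2, where 'a = real] in
          \<open>subst summable_Suc_iff, simp add: field_simps\<close>)
  qed
  then have "AE y in lborel. y \<in> {a..<b} \<longrightarrow> (\<lambda>j. f (Suc j) y) \<longlonglongrightarrow> 0"
    by (subst (asm) AE_restrict_space_iff) auto
  then show ?thesis
  proof eventually_elim
    case (elim y)
    show ?case
    proof
      assume y: "y \<in> {a..<b}"
      then have y1: "y > 1" using ab by simp
      have "(\<lambda>j. f (Suc j) y) \<longlonglongrightarrow> 0" using elim y by blast
      then have lim: "(\<lambda>j. f j y) \<longlonglongrightarrow> 0" by (rule LIMSEQ_imp_Suc)
      have M1: "y ^ (j ^ 4) \<le> real (M j)" for j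
      proof -
        have "y ^ (j ^ 4) \<le> b ^ (j ^ 4)" using y ab by (intro power_mono) auto
        also have "\<dots> \<le> real (nat \<lceil>b ^ (j ^ 4)\<rceil>)" by linarith
        also have "\<dots> \<le> real (M j)" by (simp add: M_def)
        finally show ?thesis .
      qed
      have "(\<lambda>j. W_sum y (j ^ 4) / real (j ^ 4) ^ 2) \<longlonglongrightarrow> 3 * zeta 2 / (10 * zeta 4)"
        by (rule W_sum_tendsto_fourth_powers[OF y1 M1 _ lim[unfolded f_def]]) (simp add: M_def)
      moreover have "W_sum y K \<ge> 0" for K
      proof -
        have "index_pairs y 0 = {}" by (auto simp: index_pairs_def)
        then have "W_sum y 0 = 0" by (simp add: W_sum_def)
        then show ?thesis using W_sum_mono[of 0 K y] by simp
      qed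
      ultimately show "(\<lambda>K. W_sum y K / real K ^ 2) \<longlonglongrightarrow> 3 * zeta 2 / (10 * zeta 4)"
        by (intro tendsto_of_fourth_powers W_sum_mono)
    qed
  qed
qed

theorem proposition3p7:
  "AE y in (lebesgue :: real measure). y > 1 \<longrightarrow>
     (\<exists>\<epsilon> :: nat \<Rightarrow> real. \<epsilon> \<longlonglongrightarrow> 0 \<and>
       (\<forall>K\<ge>1. (\<Sum>(k, l)\<in>index_pairs y K. W (\<lfloor>y ^ l\<rfloor> - \<lfloor>y ^ k\<rfloor>)) =
          (3 * zeta 2 / (10 * zeta 4) + \<epsilon> K) * real K ^ 2))"
proof -
  define c where "c = 3 * zeta 2 / (10 * zeta 4)"
  \<comment> \<open>Countably many intervals \<open>[a, b)\<close> with \<open>a > 1\<close> cover the half-line beyond \<open>1\<close>.\<close>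
  have "AE y in lborel. \<forall>n::nat. y \<in> {1 + 1 / real (Suc n)..<real (Suc n) + 2} \<longrightarrow>
      (\<lambda>K. W_sum y K / real K ^ 2) \<longlonglongrightarrow> c"
    unfolding AE_all_countable c_def
  proof
    fix n
    have "1 / real (Suc n) \<le> 1" by simp
    then have "1 + 1 / real (Suc n) < real (Suc n) + 2" by linarith
    then show "AE y in lborel. y \<in> {1 + 1 / real (Suc n)..<real (Suc n) + 2} \<longrightarrow>
      (\<lambda>K. W_sum y K / real K ^ 2) \<longlonglongrightarrow> 3 * zeta 2 / (10 * zeta 4)"
      by (intro AE_W_sum_tendsto) simp_all
  qed
  then have "AE y in lborel. y > 1 \<longrightarrow>
     (\<exists>\<epsilon> :: nat \<Rightarrow> real. \<epsilon> \<longlonglongrightarrow> 0 \<and> (\<forall>K\<ge>1. W_sum y K = (c + \<epsilon> K) * real K ^ 2))"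
  proof eventually_elim
    case (elim y)
    show ?case
    proof
      assume y: "y > 1"
      obtain n :: nat where n: "max (1 / (y - 1)) y < real n" using reals_Archimedean2 by blast
      then have n': "1 / (y - 1) < real (Suc n)" "y < real (Suc n) + 2" by auto
      then have "1 / real (Suc n) < y - 1" using y by (simp add: field_simps)
      then have "(\<lambda>K. W_sum y K / real K ^ 2) \<longlonglongrightarrow> c"
        using elim[rule_format, of n] n' by simp
      then have "(\<lambda>K. W_sum y K / real K ^ 2 - c) \<longlonglongrightarrow> 0" by (simp add: LIM_zero)
      then show "\<exists>\<epsilon> :: nat \<Rightarrow> real. \<epsilon> \<longlonglongrightarrow> 0 \<and> (\<forall>K\<ge>1. W_sum y K = (c + \<epsilon> K) * real K ^ 2)"
        by (intro exI[of _ "\<lambda>K. W_sum y K / real K ^ 2 - c"]) auto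
    qed
  qed
  then show ?thesis unfolding W_sum_def c_def by (rule AE_completion)
qed

end
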